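(* As $\alpha$ runs over all compositions, the functions $\{\mathcal{G}_\alpha\}$ form a basis for $QSym$, in the sense that every $\mathcal{G}_\alpha$ lies in $QSym$ and every $f\in QSym$ can be written uniquely as a (possibly infinite) linear combination $f=\sum_\alpha c_\alpha\mathcal{G}_\alpha$ with $c_\alpha\in\mathbb{Z}[\beta]$.
   Context: $\beta$ is an indeterminate. A weak composition (resp. composition) is a finite sequence of nonnegative (resp. positive) integers; weak compositions differing only by trailing zeros are identified. $|\gamma|=\sum_i\gamma_i$. For a weak composition $\gamma$, $\gamma^+$ is the composition obtained by dropping its zero parts. A formal power series $f$ in $x_1,x_2,\dots$ with coefficients in $\mathbb{Z}[\beta]$ is quasisymmetric if for all positive integers $\alpha_1,\dots,\alpha_k$ and all $i_1<\dots<i_k$, the coefficient of $x_{i_1}^{\alpha_1}\cdots x_{i_k}^{\alpha_k}$ in $f$ equals that of $x_1^{\alpha_1}\cdots x_k^{\alpha_k}$. $QSym$ is the ring of quasisymmetric formal power series (no bound on degree is imposed, since the $\mathcal{G}_\alpha$ have unbounded degree in general). Infinite linear combinations are understood coefficientwise. Skyline diagrams. The skyline diagram of $\gamma=(\gamma_1,\dots,\gamma_n)$ has left-justified rows numbered $1,\dots,n$ from top to bottom, with boxes $(i,j)$, $1\le j\le\gamma_i$, in row $i$, plus a basement box $(i,0)$ in each row containing the fixed value $b_i=i$. A set-valued filling assigns a nonempty finite set of positive integers to each non-basement box. The maximum of a box is its anchor entry; the other entries of the box are free entries. A basement box is treated as a box with the single (anchor) entry $i$. Triples, for rows $i<j$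 and a column $k\ge0$. Type A (when $\gamma_i\ge\gamma_j$): the boxes $(i,k),(i,k+1),(j,k+1)$, with anchor entries $c,a,b$ respectively. Type B (when $\gamma_i<\gamma_j$): the boxes $(i,k),(j,k),(j,k+1)$, with anchor entries $b,c,a$ respectively. (All three boxes must exist; basement boxes are allowed.) A triple is an inversion triple if $b>c\ge a$ or $c\ge a>b$. A set-valued filling is semistandard if: (S1) entries do not repeat in a column; (S2) rows, including the basement, are weakly decreasing from left to right, where for sets $A\ge B$ means $\min A\ge\max B$; (S3) every triple of anchor entries (including basement boxes) is an inversion triple; (S4) every free entry is in the highest (lowest-numbered) row possible within its column: a free entry $x$ in column $j$ lies in the smallest-numbered row $i$ such that the box $(i,j)$ exists, $x$ is smaller than the anchor entry of $(i,j)$ (so $x$ is free there), and placing $x$ there does not violate (S2), i.e. $x$ is at least the anchor entry of $(i,j+1)$ if that box exists. $\mathsf{SetSkyFill}(\gamma)$ is the set of semistandard set-valued fillings of shape $\gamma$ with basement $b_i=i$. For such $F$, $|F|$ is the total number of entries (not counting the basement) and $x^F=\prod_i x_i^{m_i}$, where $m_i$ is the number of occurrences of $i$ in $F$ outside the basement. The combinatorial Lascoux atom is $$\mathcal{L}_\gamma=\sum_{F\in\mathsf{SetSkyFill}(\gamma)}\beta^{|F|-|\gamma|}x^F\in\mathbb{Z}[\beta][x_1,\dots,x_n].$$ For a composition $\alpha$, the quasisymmetric Grothendieck function is $\mathcal{G}_\alpha=\sum_{\gamma:\ \gamma^+=\alpha}\mathcal{L}_\gamma$, the sum over all weak compositions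 $\gamma$ with $\gamma^+=\alpha$. *)

theory Defs
  imports "HOL-Library.Poly_Mapping" "HOL-Library.FuncSet" "HOL-Computational_Algebra.Polynomial"
begin

text \<open>
  Rows, variables and entries of fillings are numbered from 0 instead of from 1: the natural
  number \<open>i\<close> stands for row \<open>i + 1\<close>, for the variable \<open>x\<^bsub>i+1\<^esub>\<close> and for the entry \<open>i + 1\<close>. Only
  the order of these labels ever matters. Columns are numbered as usual, with column 0 being the
  basement.

  Coefficients lie in \<open>\<int>[\<beta>]\<close>, the type \<^typ>\<open>int poly\<close>; \<open>\<beta>\<close> is its indeterminate, so
  \<open>\<beta>\<^sup>k\<close> is \<^term>\<open>monom 1 k :: int poly\<close>.
\<close>

section \<open>Power series and quasisymmetric functions\<close>

type_synonym expo = "nat \<Rightarrow>\<^sub>0 nat"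
type_synonym power_series = "expo \<Rightarrow> int poly"

text \<open>Sums of possibly infinite families of power series, taken coefficientwise.\<close>

definition coeff_sum :: "('i \<Rightarrow> power_series) \<Rightarrow> 'i set \<Rightarrow> power_series" where
  "coeff_sum g A = (\<lambda>m. \<Sum>a\<in>{a \<in> A. g a m \<noteq> 0}. g a m)"

definition has_coeff_sum :: "('i \<Rightarrow> power_series) \<Rightarrow> 'i set \<Rightarrow> power_series \<Rightarrow> bool" where
  "has_coeff_sum g A f \<longleftrightarrow> (\<forall>m. finite {a \<in> A. g a m \<noteq> 0}) \<and> f = coeff_sum g A"

definition compositions :: "nat list set" where
  "compositions = {\<alpha>. \<forall>a\<in>set \<alpha>. 0 < a}"

text \<open>The exponent of \<open>x\<^bsub>i\<^sub>1\<^esub>\<^bsup>\<alpha>\<^sub>1\<^esup> \<dots> x\<^bsub>i\<^sub>k\<^esub>\<^bsup>\<alpha>\<^sub>k\<^esup>\<close> for lists \<open>is = [i\<^sub>1,\<dots>,i\<^sub>k]\<close> and \<open>\<alpha> = [\<alpha>\<^sub>1,\<dots>,\<alpha>\<^sub>k]\<close>.\<close>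

definition expo_of :: "nat list \<Rightarrow> nat list \<Rightarrow> expo" where
  "expo_of is \<alpha> = (\<Sum>j<length \<alpha>. Poly_Mapping.single (is ! j) (\<alpha> ! j))"

definition QSym :: "power_series set" where
  "QSym = {f. \<forall>\<alpha>\<in>compositions. \<forall>is. length is = length \<alpha> \<and> sorted_wrt (<) is \<longrightarrow>
     f (expo_of is \<alpha>) = f (expo_of [0..<length \<alpha>] \<alpha>)}"

section \<open>Skyline diagrams and set-valued fillings\<close>

definition boxes :: "nat list \<Rightarrow> (nat \<times> nat) set" where
  "boxes \<gamma> = {(i, j). i < length \<gamma> \<and> 1 \<le> j \<and> j \<le> \<gamma> ! i}"

definition boxes_basement :: "nat list \<Rightarrow> (nat \<times> nat) set" where
  "boxes_basement \<gamma> = {(i, j). i < length \<gamma> \<and> j \<le> \<gamma> ! i}"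

text \<open>\<open>F i j\<close> is the set in box \<open>(i, j)\<close>. The basement is part of the filling, and positions
  outside the diagram carry the empty set, so that a filling is determined by its boxes.\<close>

type_synonym filling = "nat \<Rightarrow> nat \<Rightarrow> nat set"

definition set_valued_filling :: "nat list \<Rightarrow> filling \<Rightarrow> bool" where
  "set_valued_filling \<gamma> F \<longleftrightarrow>
     (\<forall>(i, j)\<in>boxes \<gamma>. finite (F i j) \<and> F i j \<noteq> {}) \<and>
     (\<forall>i<length \<gamma>. F i 0 = {i}) \<and>
     (\<forall>i j. (i, j) \<notin> boxes_basement \<gamma> \<longrightarrow> F i j = {})"

definition anchor :: "filling \<Rightarrow> nat \<Rightarrow> nat \<Rightarrow> nat" where
  "anchor F i j = Max (F i j)"

definition inversion_triple :: "nat \<Rightarrow> nat \<Rightarrow> nat \<Rightarrow> bool" where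
  "inversion_triple a b c \<longleftrightarrow> (b > c \<and> c \<ge> a) \<or> (c \<ge> a \<and> a > b)"

definition column_distinct :: "nat list \<Rightarrow> filling \<Rightarrow> bool" where
  "column_distinct \<gamma> F \<longleftrightarrow>
     (\<forall>i i' j. (i, j) \<in> boxes_basement \<gamma> \<and> (i', j) \<in> boxes_basement \<gamma> \<and> i \<noteq> i' \<longrightarrow>
        F i j \<inter> F i' j = {})"

definition rows_decreasing :: "nat list \<Rightarrow> filling \<Rightarrow> bool" where
  "rows_decreasing \<gamma> F \<longleftrightarrow>
     (\<forall>i j. (i, Suc j) \<in> boxes \<gamma> \<longrightarrow> Min (F i j) \<ge> Max (F i (Suc j)))"

definition type_A_inversion :: "nat list \<Rightarrow> filling \<Rightarrow> bool" where
  "type_A_inversion \<gamma> F \<longleftrightarrow>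
     (\<forall>i j k. i < j \<and> j < length \<gamma> \<and> \<gamma> ! i \<ge> \<gamma> ! j \<and>
        {(i, k), (i, Suc k), (j, Suc k)} \<subseteq> boxes_basement \<gamma> \<longrightarrow>
        inversion_triple (anchor F i (Suc k)) (anchor F j (Suc k)) (anchor F i k))"

definition type_B_inversion :: "nat list \<Rightarrow> filling \<Rightarrow> bool" where
  "type_B_inversion \<gamma> F \<longleftrightarrow>
     (\<forall>i j k. i < j \<and> j < length \<gamma> \<and> \<gamma> ! i < \<gamma> ! j \<and>
        {(i, k), (j, k), (j, Suc k)} \<subseteq> boxes_basement \<gamma> \<longrightarrow>
        inversion_triple (anchor F j (Suc k)) (anchor F i k) (anchor F j k))"

text \<open>Row \<open>i\<close> could hold \<open>x\<close> as a free entry in column \<open>j\<close>. No comparison with the box on the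
  left is needed: if \<open>x\<close> is below the anchor of \<open>(i, j)\<close>, it is below everything in
  \<open>(i, j - 1)\<close>.\<close>

definition can_be_free :: "nat list \<Rightarrow> filling \<Rightarrow> nat \<Rightarrow> nat \<Rightarrow> nat \<Rightarrow> bool" where
  "can_be_free \<gamma> F x i j \<longleftrightarrow>
     (i, j) \<in> boxes \<gamma> \<and> x < anchor F i j \<and>
     ((i, Suc j) \<in> boxes \<gamma> \<longrightarrow> anchor F i (Suc j) \<le> x)"

definition free_entries_highest :: "nat list \<Rightarrow> filling \<Rightarrow> bool" where
  "free_entries_highest \<gamma> F \<longleftrightarrow>
     (\<forall>(i, j)\<in>boxes \<gamma>. \<forall>x\<in>F i j. x \<noteq> anchor F i j \<longrightarrow>
        i = (LEAST r. can_be_free \<gamma> F x r j))"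

definition semistandard :: "nat list \<Rightarrow> filling \<Rightarrow> bool" where
  "semistandard \<gamma> F \<longleftrightarrow>
     column_distinct \<gamma> F \<and> rows_decreasing \<gamma> F \<and>
     type_A_inversion \<gamma> F \<and> type_B_inversion \<gamma> F \<and> free_entries_highest \<gamma> F"

definition SetSkyFill :: "nat list \<Rightarrow> filling set" where
  "SetSkyFill \<gamma> = {F. set_valued_filling \<gamma> F \<and> semistandard \<gamma> F}"

section \<open>Lascoux atoms and quasisymmetric Grothendieck functions\<close>

definition num_entries :: "nat list \<Rightarrow> filling \<Rightarrow> nat" where
  "num_entries \<gamma> F = (\<Sum>(i, j)\<in>boxes \<gamma>. card (F i j))"

definition filling_expo :: "nat list \<Rightarrow> filling \<Rightarrow> expo" where
  "filling_expo \<gamma> F = (\<Sum>(i, j)\<in>boxes \<gamma>. \<Sum>e\<in>F i j. Poly_Mapping.single e 1)"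

text \<open>The type \<^typ>\<open>expo \<Rightarrow>\<^sub>0 int poly\<close> is the polynomial ring over \<open>\<int>[\<beta>]\<close> in all the variables.\<close>

definition lascoux_atom :: "nat list \<Rightarrow> (expo \<Rightarrow>\<^sub>0 int poly)" where
  "lascoux_atom \<gamma> =
     (\<Sum>F\<in>SetSkyFill \<gamma>.
        Poly_Mapping.single (filling_expo \<gamma> F) (monom 1 (num_entries \<gamma> F - sum_list \<gamma>)))"

text \<open>Weak compositions up to trailing zeros are represented by the lists not ending in 0.\<close>

definition weak_compositions :: "nat list set" where
  "weak_compositions = {\<gamma>. \<gamma> \<noteq> [] \<longrightarrow> last \<gamma> \<noteq> 0}"

definition flat :: "nat list \<Rightarrow> nat list" where
  "flat \<gamma> = filter (\<lambda>a. a \<noteq> 0) \<gamma>"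

definition grothendieck :: "nat list \<Rightarrow> power_series" where
  "grothendieck \<alpha> =
     coeff_sum (\<lambda>\<gamma>. Poly_Mapping.lookup (lascoux_atom \<gamma>)) {\<gamma> \<in> weak_compositions. flat \<gamma> = \<alpha>}"

section \<open>The sums above are well defined\<close>

lemma finite_boxes: "finite (boxes \<gamma>)"
proof (rule finite_subset)
  show "boxes \<gamma> \<subseteq> (SIGMA i:{..<length \<gamma>}. {..\<gamma> ! i})" by (auto simp: boxes_def)
qed simp

lemma SetSkyFill_entry_le:
  assumes F: "F \<in> SetSkyFill \<gamma>" and "i < length \<gamma>" "j \<le> \<gamma> ! i" "x \<in> F i j"
  shows "x \<le> i"
  using assms(3,4)
proof (induction j arbitrary: x)
  case 0
  then show ?case using F assms(2) by (auto simp: SetSkyFill_def set_valued_filling_def)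
next
  case (Suc j)
  have b: "(i, Suc j) \<in> boxes \<gamma>" using Suc.prems assms(2) by (auto simp: boxes_def)
  have fin: "finite (F i k) \<and> F i k \<noteq> {}" if "k \<le> \<gamma> ! i" for k
    using F assms(2) that
    by (cases k) (auto simp: SetSkyFill_def set_valued_filling_def boxes_def)
  have "Max (F i (Suc j)) \<le> Min (F i j)"
    using F b by (auto simp: SetSkyFill_def semistandard_def rows_decreasing_def)
  moreover have "x \<le> Max (F i (Suc j))" using fin Suc.prems by auto
  moreover have "Min (F i j) \<le> i" using Suc.IH Suc.prems(1) fin[of j] Min_in[of "F i j"] by auto
  ultimately show ?case by linarith
qed

lemma finite_SetSkyFill: "finite (SetSkyFill \<gamma>)"
proof -
  let ?h = "\<lambda>F :: filling. {(i, j, x). x \<in> F i j}"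
  let ?B = "(SIGMA i:{..<length \<gamma>}. {..\<gamma> ! i} \<times> {..i})"
  have "?h F \<subseteq> ?B" if "F \<in> SetSkyFill \<gamma>" for F
  proof
    fix p assume "p \<in> ?h F"
    then obtain i j x where p: "p = (i, j, x)" "x \<in> F i j" by auto
    have "(i, j) \<in> boxes_basement \<gamma>"
    proof (rule ccontr)
      assume "(i, j) \<notin> boxes_basement \<gamma>"
      then have "F i j = {}" using that by (simp add: SetSkyFill_def set_valued_filling_def)
      then show False using p(2) by simp
    qed
    then show "p \<in> ?B"
      using SetSkyFill_entry_le[OF that _ _ p(2)] p(1) by (auto simp: boxes_basement_def)
  qed
  then have "?h ` SetSkyFill \<gamma> \<subseteq> Pow ?B" by blast
  then have "finite (?h ` SetSkyFill \<gamma>)" by (rule finite_subset) simp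
  moreover have "inj_on ?h (SetSkyFill \<gamma>)" by (rule inj_onI) (auto simp: set_eq_iff fun_eq_iff)
  ultimately show ?thesis by (rule finite_imageD)
qed

lemma SetSkyFill_first_column:
  assumes F: "F \<in> SetSkyFill \<gamma>" and "i < length \<gamma>" "\<gamma> ! i \<noteq> 0"
  shows "anchor F i 1 = i"
  using assms(2,3)
proof (induction i rule: less_induct)
  case (less j)
  have box: "F i 1 \<noteq> {} \<and> finite (F i 1) \<and> anchor F i 1 \<in> F i 1"
    if "i < length \<gamma>" "\<gamma> ! i \<noteq> 0" for i
    using F that unfolding anchor_def
    by (auto simp: SetSkyFill_def set_valued_filling_def boxes_def)
  have base: "anchor F i 0 = i" if "i < length \<gamma>" for i
    using F that by (auto simp: SetSkyFill_def set_valued_filling_def anchor_def)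
  have le: "anchor F j 1 \<le> j"
    using SetSkyFill_entry_le[OF F less.prems(1), of 1] box[OF less.prems] less.prems by auto
  have "anchor F j 1 \<noteq> i" if ij: "i < j" for i
  proof (cases "\<gamma> ! i = 0")
    case True
    have "inversion_triple (anchor F j (Suc 0)) (anchor F i 0) (anchor F j 0)"
      using F ij less.prems True
      by (auto simp: SetSkyFill_def semistandard_def type_B_inversion_def boxes_basement_def)
    then show ?thesis using base ij less.prems by (auto simp: inversion_triple_def)
  next
    case False
    have "anchor F i 1 = i" using less.IH ij less.prems False by auto
    moreover have "F i 1 \<inter> F j 1 = {}"
      using F ij less.prems False
      by (auto simp: SetSkyFill_def semistandard_def column_distinct_def boxes_basement_def)
    ultimately show ?thesis using box[of i] box[of j] ij less.prems False by auto
  qed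
  with le show ?case by (metis linorder_neqE_nat not_le)
qed

lemma SetSkyFill_expo:
  assumes F: "F \<in> SetSkyFill \<gamma>" and i: "i < length \<gamma>" "\<gamma> ! i \<noteq> 0"
  shows "i \<in> Poly_Mapping.keys (filling_expo \<gamma> F)"
proof -
  have b: "(i, 1) \<in> boxes \<gamma>" using i by (auto simp: boxes_def)
  then have fin: "finite (F i 1)" "F i 1 \<noteq> {}"
    using F by (auto simp: SetSkyFill_def set_valued_filling_def)
  then have "i \<in> F i 1"
    using SetSkyFill_first_column[OF assms] Max_in unfolding anchor_def by metis
  then have "0 < (\<Sum>e\<in>F i 1. Poly_Mapping.lookup (Poly_Mapping.single e (1::nat)) i)"
    using fin by (subst sum_pos2[of _ i]) auto
  also have "\<dots> \<le> (\<Sum>p\<in>boxes \<gamma>. case p of (i', j) \<Rightarrow>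
      (\<Sum>e\<in>F i' j. Poly_Mapping.lookup (Poly_Mapping.single e (1::nat)) i))"
    using member_le_sum[OF b, of "\<lambda>p. case p of (i', j) \<Rightarrow>
      (\<Sum>e\<in>F i' j. Poly_Mapping.lookup (Poly_Mapping.single e (1::nat)) i)"] finite_boxes by auto
  also have "\<dots> = Poly_Mapping.lookup (filling_expo \<gamma> F) i"
    by (simp add: filling_expo_def lookup_sum case_prod_unfold)
  finally show ?thesis by (simp add: Poly_Mapping.in_keys_iff)
qed

lemma finite_bounded_lists: "finite {\<gamma> :: nat list. length \<gamma> \<le> n \<and> set \<gamma> \<subseteq> {..m}}"
  using finite_lists_length_le[of "{..m}" n] by (simp add: conj_commute)

lemma grothendieck_has_coeff_sum:
  "has_coeff_sum (\<lambda>\<gamma>. Poly_Mapping.lookup (lascoux_atom \<gamma>)) {\<gamma> \<in> weak_compositions. flat \<gamma> = \<alpha>}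
     (grothendieck \<alpha>)"
  unfolding has_coeff_sum_def
proof (intro conjI allI)
  fix m
  let ?S = "{\<gamma> \<in> {\<gamma> \<in> weak_compositions. flat \<gamma> = \<alpha>}. Poly_Mapping.lookup (lascoux_atom \<gamma>) m \<noteq> 0}"
  have "length \<gamma> \<le> Suc (Max (insert 0 (Poly_Mapping.keys m))) \<and> set \<gamma> \<subseteq> {..Max (insert 0 (set \<alpha>))}"
    if g: "\<gamma> \<in> ?S" for \<gamma>
  proof
    have "\<exists>F\<in>SetSkyFill \<gamma>. filling_expo \<gamma> F = m"
    proof (rule ccontr)
      assume "\<not> ?thesis"
      then have "Poly_Mapping.lookup (lascoux_atom \<gamma>) m = 0"
        by (auto simp: lascoux_atom_def lookup_sum lookup_single when_def intro!: sum.neutral)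
      then show False using g by simp
    qed
    then obtain F where F: "F \<in> SetSkyFill \<gamma>" "filling_expo \<gamma> F = m" by blast
    show "length \<gamma> \<le> Suc (Max (insert 0 (Poly_Mapping.keys m)))"
    proof (cases "\<gamma> = []")
      case False
      then have "\<gamma> ! (length \<gamma> - 1) \<noteq> 0"
        using g by (auto simp: weak_compositions_def last_conv_nth)
      then have "length \<gamma> - 1 \<in> Poly_Mapping.keys m" using SetSkyFill_expo[OF F(1)] F(2) False by auto
      then have "length \<gamma> - 1 \<le> Max (insert 0 (Poly_Mapping.keys m))" by (intro Max_ge) auto
      then show ?thesis by linarith
    qed simp
    show "set \<gamma> \<subseteq> {..Max (insert 0 (set \<alpha>))}"
    proof
      fix a assume "a \<in> set \<gamma>"
      then have "a \<in> insert 0 (set \<alpha>)" using g by (auto simp: flat_def)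
      then show "a \<in> {..Max (insert 0 (set \<alpha>))}" by (simp only: atMost_iff) (rule Max_ge, auto)
    qed
  qed
  then have "?S \<subseteq> {\<gamma>. length \<gamma> \<le> Suc (Max (insert 0 (Poly_Mapping.keys m))) \<and>
      set \<gamma> \<subseteq> {..Max (insert 0 (set \<alpha>))}}" by blast
  then show "finite ?S" by (rule finite_subset) (rule finite_bounded_lists)
qed (simp add: grothendieck_def)

end

theory Submission
  imports Defs
begin

text \<open>
  The first column of a semistandard filling repeats the basement, so the conditions that involve
  the basement are automatic and an order preserving relabelling of rows and entries together
  preserves semistandardness. The coefficient of \<open>m\<close> in \<open>\<G>\<^sub>\<alpha>\<close> is \<open>\<beta>\<^bsup>|m| - |\<alpha>|\<^esup>\<close> times the number of
  fillings with exponent \<open>m\<close>, over all \<open>\<gamma>\<close> with \<open>\<gamma>\<^sup>+ = \<alpha>\<close>; this number depends only on the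
  nonzero exponents in order, which is quasisymmetry.

  For the basis property, let a filling contribute to the coefficient of the monomial
  quasisymmetric function \<open>M\<^sub>\<delta>\<close> in \<open>\<G>\<^sub>\<alpha>\<close>. Its nonempty rows are among the \<open>\<ell>(\<delta>)\<close> letters, so
  \<open>\<ell>(\<alpha>) \<le> \<ell>(\<delta>)\<close>. If equality holds then \<open>\<gamma> = \<alpha>\<close>, and since the entries of row \<open>i\<close> are at most
  \<open>i\<close>, comparing, for \<open>k = \<ell>(\<delta>)\<close>, \<open>\<Sum>\<^sub>i (k - i) \<alpha>\<^sub>i\<close> with \<open>\<Sum>\<^sub>i (k - i) \<delta>\<^sub>i\<close> shows that \<open>\<alpha>\<close> precedes \<open>\<delta>\<close>, or \<open>\<alpha> = \<delta>\<close> and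
  row \<open>i\<close> consists of \<open>i\<close> alone. So the transition matrix is unitriangular for a well-founded order.
\<close>

section \<open>Coefficients as numbers of fillings\<close>

lemma boxes_iff: "(i, j) \<in> boxes \<gamma> \<longleftrightarrow> 1 \<le> j \<and> j \<le> nth_default 0 \<gamma> i"
  by (auto simp: boxes_def nth_default_def)

text \<open>Since the first column repeats the basement, triples that meet the basement have anchors
  of this form: the first for type A, the second for type B.\<close>

lemma inversion_triple_basement:
  "i < j \<Longrightarrow> inversion_triple i j i" "i < j \<Longrightarrow> inversion_triple j i j"
  by (auto simp: inversion_triple_def)

text \<open>\<open>SetSkyFill_first_column\<close> fixes the anchors in column 1, and then every
  condition involving column 0 holds by itself. What remains mentions only boxes outside the
  basement, the form needed to move rows and entries by one map.\<close>

lemma SetSkyFill_iff: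
  "F \<in> SetSkyFill \<gamma> \<longleftrightarrow> set_valued_filling \<gamma> F \<and>
     (\<forall>i. (i, 1) \<in> boxes \<gamma> \<longrightarrow> anchor F i 1 = i) \<and>
     (\<forall>i i' j. (i, j) \<in> boxes \<gamma> \<and> (i', j) \<in> boxes \<gamma> \<and> i \<noteq> i' \<longrightarrow> F i j \<inter> F i' j = {}) \<and>
     (\<forall>i j. (i, j) \<in> boxes \<gamma> \<and> (i, Suc j) \<in> boxes \<gamma> \<longrightarrow> (\<forall>x\<in>F i j. \<forall>y\<in>F i (Suc j). y \<le> x)) \<and>
     (\<forall>i j k. i < j \<and> \<gamma> ! j \<le> \<gamma> ! i \<and> (i, k) \<in> boxes \<gamma> \<and> (i, Suc k) \<in> boxes \<gamma> \<and>
        (j, Suc k) \<in> boxes \<gamma> \<longrightarrow>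
        inversion_triple (anchor F i (Suc k)) (anchor F j (Suc k)) (anchor F i k)) \<and>
     (\<forall>i j k. i < j \<and> \<gamma> ! i < \<gamma> ! j \<and> (i, k) \<in> boxes \<gamma> \<and> (j, k) \<in> boxes \<gamma> \<and>
        (j, Suc k) \<in> boxes \<gamma> \<longrightarrow>
        inversion_triple (anchor F j (Suc k)) (anchor F i k) (anchor F j k)) \<and>
     (\<forall>i j x. (i, j) \<in> boxes \<gamma> \<and> x \<in> F i j \<and> x < anchor F i j \<longrightarrow>
        (\<forall>r<i. \<not> can_be_free \<gamma> F x r j))"
    (is "_ \<longleftrightarrow> ?V \<and> ?first \<and> ?col \<and> ?row \<and> ?A \<and> ?B \<and> ?free")
proof -
  have free: "free_entries_highest \<gamma> F \<longleftrightarrow> ?free" if V: ?V and row: ?row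
  proof -
    \<comment> \<open>By the row condition a free entry is admissible in its own row, so being the
      \<open>LEAST\<close> admissible row means exactly that no smaller row is admissible.\<close>
    have fb: "can_be_free \<gamma> F x i j" if "(i, j) \<in> boxes \<gamma>" "x \<in> F i j" "x < anchor F i j" for i j x
    proof -
      have "anchor F i (Suc j) \<le> x" if s: "(i, Suc j) \<in> boxes \<gamma>"
      proof -
        have "anchor F i (Suc j) \<in> F i (Suc j)"
          using V s unfolding anchor_def by (intro Max_in) (auto simp: set_valued_filling_def)
        then show ?thesis using row s \<open>(i, j) \<in> boxes \<gamma>\<close> \<open>x \<in> F i j\<close> by blast
      qed
      then show ?thesis using that by (auto simp: can_be_free_def)
    qed
    have lt: "x \<noteq> anchor F i j \<longleftrightarrow> x < anchor F i j" if "(i, j) \<in> boxes \<gamma>" "x \<in> F i j" for i j x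
      using V that Max_ge[of "F i j" x] by (auto simp: set_valued_filling_def anchor_def le_less)
    have least: "i = (LEAST r. can_be_free \<gamma> F x r j) \<longleftrightarrow> (\<forall>r<i. \<not> can_be_free \<gamma> F x r j)"
      if "can_be_free \<gamma> F x i j" for i j x
      using that by (metis LeastI not_less_Least linorder_neqE_nat)
    have "i = (LEAST r. can_be_free \<gamma> F x r j) \<longleftrightarrow> (\<forall>r<i. \<not> can_be_free \<gamma> F x r j)"
      if "(i, j) \<in> boxes \<gamma>" "x \<in> F i j" "x < anchor F i j" for i j x
      using that by (intro least fb)
    then show ?thesis unfolding free_entries_highest_def using lt by (simp add: Ball_def) blast
  qed
  show ?thesis
  proof
    assume F: "F \<in> SetSkyFill \<gamma>"
    then have V: ?V and col: "column_distinct \<gamma> F" and rows: "rows_decreasing \<gamma> F"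
      and A: "type_A_inversion \<gamma> F" and B: "type_B_inversion \<gamma> F"
      and fr: "free_entries_highest \<gamma> F"
      by (auto simp: SetSkyFill_def semistandard_def)
    have bb: "(i, j) \<in> boxes \<gamma> \<Longrightarrow> (i, j) \<in> boxes_basement \<gamma> \<and> i < length \<gamma>" for i j
      by (auto simp: boxes_def boxes_basement_def)
    have row: ?row
    proof (intro allI impI ballI)
      fix i j x y
      assume *: "(i, j) \<in> boxes \<gamma> \<and> (i, Suc j) \<in> boxes \<gamma>" "x \<in> F i j" "y \<in> F i (Suc j)"
      then have "finite (F i j)" "finite (F i (Suc j))"
        using V by (auto simp: set_valued_filling_def)
      then have "y \<le> Max (F i (Suc j))" "Min (F i j) \<le> x" using * by auto
      moreover have "Max (F i (Suc j)) \<le> Min (F i j)" using rows * by (simp add: rows_decreasing_def)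
      ultimately show "y \<le> x" by linarith
    qed
    have first: ?first using SetSkyFill_first_column[OF F] by (auto simp: boxes_def)
    have c: ?col using col bb unfolding column_distinct_def by blast
    have a: ?A
      by (intro allI impI, rule type_A_inversion_def[THEN iffD1, OF A, rule_format])
        (simp add: boxes_def boxes_basement_def)
    have b: ?B
      by (intro allI impI, rule type_B_inversion_def[THEN iffD1, OF B, rule_format])
        (simp add: boxes_def boxes_basement_def)
    show "?V \<and> ?first \<and> ?col \<and> ?row \<and> ?A \<and> ?B \<and> ?free"
      by (intro conjI V first c row a b free[OF V row, THEN iffD1, OF fr])
  next
    assume R: "?V \<and> ?first \<and> ?col \<and> ?row \<and> ?A \<and> ?B \<and> ?free"
    then have V: ?V and first: ?first and col: ?col and row: ?row and A: ?A and B: ?B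
      and fr: ?free by - (elim conjE, assumption)+
    have base: "F i 0 = {i}" "anchor F i 0 = i" if "i < length \<gamma>" for i
      using V that by (auto simp: set_valued_filling_def anchor_def)
    have bb: "(i, Suc k) \<in> boxes_basement \<gamma> \<longleftrightarrow> (i, Suc k) \<in> boxes \<gamma>" for i k
      by (auto simp: boxes_def boxes_basement_def)
    have "column_distinct \<gamma> F"
      unfolding column_distinct_def
    proof (intro allI impI)
      fix i i' j
      assume *: "(i, j) \<in> boxes_basement \<gamma> \<and> (i', j) \<in> boxes_basement \<gamma> \<and> i \<noteq> i'"
      show "F i j \<inter> F i' j = {}"
      proof (cases j)
        case 0
        then show ?thesis using * base by (auto simp: boxes_basement_def)
      next
        case (Suc k)
        then show ?thesis using * col bb by blast
      qed
    qed
    moreover have "rows_decreasing \<gamma> F"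
      unfolding rows_decreasing_def
    proof (intro allI impI)
      fix i j assume *: "(i, Suc j) \<in> boxes \<gamma>"
      show "Max (F i (Suc j)) \<le> Min (F i j)"
      proof (cases j)
        case 0
        then show ?thesis using * base first by (auto simp: boxes_def anchor_def)
      next
        case (Suc k)
        then have b: "(i, j) \<in> boxes \<gamma>" using * by (auto simp: boxes_def)
        then have "Max (F i (Suc j)) \<in> F i (Suc j)" "Min (F i j) \<in> F i j"
          using V * by (auto simp: set_valued_filling_def intro!: Max_in Min_in)
        then show ?thesis using row * b by blast
      qed
    qed
    moreover have "type_A_inversion \<gamma> F"
      unfolding type_A_inversion_def
    proof (intro allI impI)
      fix i j k
      assume *: "i < j \<and> j < length \<gamma> \<and> \<gamma> ! j \<le> \<gamma> ! i \<and>
        {(i, k), (i, Suc k), (j, Suc k)} \<subseteq> boxes_basement \<gamma>"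
      show "inversion_triple (anchor F i (Suc k)) (anchor F j (Suc k)) (anchor F i k)"
      proof (cases k)
        case 0
        then show ?thesis using * base first bb inversion_triple_basement(1)[of i j] by simp
      next
        case (Suc l)
        then show ?thesis using * A bb by simp
      qed
    qed
    moreover have "type_B_inversion \<gamma> F"
      unfolding type_B_inversion_def
    proof (intro allI impI)
      fix i j k
      assume *: "i < j \<and> j < length \<gamma> \<and> \<gamma> ! i < \<gamma> ! j \<and>
        {(i, k), (j, k), (j, Suc k)} \<subseteq> boxes_basement \<gamma>"
      show "inversion_triple (anchor F j (Suc k)) (anchor F i k) (anchor F j k)"
      proof (cases k)
        case 0
        then show ?thesis using * base first bb inversion_triple_basement(2)[of i j] by simp
      next
        case (Suc l)
        then show ?thesis using * B bb by simp
      qed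
    qed
    ultimately show "F \<in> SetSkyFill \<gamma>"
      using V fr free[OF V row] by (simp add: SetSkyFill_def semistandard_def)
  qed
qed

section \<open>Exponents of fillings and double counting\<close>

lemma lookup_filling_expo:
  assumes "set_valued_filling \<gamma> F"
  shows "Poly_Mapping.lookup (filling_expo \<gamma> F) x = card {(i, j) \<in> boxes \<gamma>. x \<in> F i j}"
proof -
  have "Poly_Mapping.lookup (filling_expo \<gamma> F) x =
      (\<Sum>(i, j)\<in>boxes \<gamma>. \<Sum>e\<in>F i j. if e = x then 1 else 0)"
    by (simp add: filling_expo_def lookup_sum case_prod_unfold lookup_single when_def
        del: One_nat_def)
  also have "\<dots> = (\<Sum>(i, j)\<in>boxes \<gamma>. if x \<in> F i j then 1 else 0)"
    using assms by (intro sum.cong) (auto simp: set_valued_filling_def)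
  also have "\<dots> = card {(i, j) \<in> boxes \<gamma>. x \<in> F i j}"
    using finite_boxes by (simp add: case_prod_unfold flip: sum.inter_filter)
  finally show ?thesis .
qed

lemma keys_filling_expo:
  assumes "set_valued_filling \<gamma> F"
  shows "Poly_Mapping.keys (filling_expo \<gamma> F) = (\<Union>(i, j)\<in>boxes \<gamma>. F i j)"
proof -
  have "x \<in> Poly_Mapping.keys (filling_expo \<gamma> F) \<longleftrightarrow> {(i, j) \<in> boxes \<gamma>. x \<in> F i j} \<noteq> {}" for x
  proof -
    have "finite {(i, j) \<in> boxes \<gamma>. x \<in> F i j}" by (rule finite_subset[OF _ finite_boxes]) auto
    then show ?thesis by (simp add: in_keys_iff lookup_filling_expo[OF assms] del: Collect_empty_eq)
  qed
  then show ?thesis by blast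
qed

text \<open>Both sides count pairs of a box and an entry in it, weighted by \<open>h\<close>.
  Constant \<open>h\<close> gives the degree; a decreasing \<open>h\<close> gives the weight
  comparison behind unitriangularity.\<close>

lemma sum_filling_expo:
  fixes h :: "nat \<Rightarrow> nat"
  assumes V: "set_valued_filling \<gamma> F"
  defines "m \<equiv> filling_expo \<gamma> F"
  shows "(\<Sum>x\<in>Poly_Mapping.keys m. h x * Poly_Mapping.lookup m x) =
    (\<Sum>(i, j)\<in>boxes \<gamma>. \<Sum>x\<in>F i j. h x)"
proof -
  have "(\<Sum>x\<in>Poly_Mapping.keys m. h x * Poly_Mapping.lookup m x) =
      (\<Sum>x\<in>Poly_Mapping.keys m. \<Sum>(i, j)\<in>boxes \<gamma>. if x \<in> F i j then h x else 0)"
    unfolding m_def lookup_filling_expo[OF V] using finite_boxes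
    by (simp add: case_prod_unfold mult.commute flip: sum.inter_filter)
  also have "\<dots> = (\<Sum>(i, j)\<in>boxes \<gamma>. \<Sum>x\<in>Poly_Mapping.keys m. if x \<in> F i j then h x else 0)"
    by (subst sum.swap) (simp add: case_prod_unfold)
  also have "\<dots> = (\<Sum>(i, j)\<in>boxes \<gamma>. \<Sum>x\<in>F i j. h x)"
  proof (rule sum.cong[OF refl], clarify)
    fix i j assume "(i, j) \<in> boxes \<gamma>"
    then have "{x \<in> Poly_Mapping.keys m. x \<in> F i j} = F i j"
      by (auto simp: m_def keys_filling_expo[OF V])
    then show "(\<Sum>x\<in>Poly_Mapping.keys m. if x \<in> F i j then h x else 0) = (\<Sum>x\<in>F i j. h x)"
      by (simp flip: sum.inter_filter)
  qed
  finally show ?thesis .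
qed

text \<open>Hence fillings of one shape with the same exponent carry the same power of
  \<beta>.\<close>

lemma num_entries_eq:
  assumes "set_valued_filling \<gamma> F"
  shows "num_entries \<gamma> F =
    (\<Sum>x\<in>Poly_Mapping.keys (filling_expo \<gamma> F). Poly_Mapping.lookup (filling_expo \<gamma> F) x)"
  using sum_filling_expo[OF assms, of "\<lambda>_. 1"] by (simp add: num_entries_def)

text \<open>Carrying the shape along with the filling turns a coefficient, which is a sum over
  shapes, into one cardinality.\<close>

definition fillings_of :: "nat list \<Rightarrow> expo \<Rightarrow> (nat list \<times> filling) set" where
  "fillings_of \<alpha> m = (SIGMA \<gamma>:{\<gamma> \<in> weak_compositions. flat \<gamma> = \<alpha>}.
     {F \<in> SetSkyFill \<gamma>. filling_expo \<gamma> F = m})"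

lemma sum_list_flat: "sum_list (flat \<gamma>) = sum_list \<gamma>"
  by (induction \<gamma>) (auto simp: flat_def)

lemma lookup_lascoux_atom:
  "Poly_Mapping.lookup (lascoux_atom \<gamma>) m =
     monom (of_nat (card {F \<in> SetSkyFill \<gamma>. filling_expo \<gamma> F = m}))
       ((\<Sum>x\<in>Poly_Mapping.keys m. Poly_Mapping.lookup m x) - sum_list \<gamma>)"
proof -
  have "Poly_Mapping.lookup (lascoux_atom \<gamma>) m =
      (\<Sum>F\<in>SetSkyFill \<gamma>. if filling_expo \<gamma> F = m then monom 1 (num_entries \<gamma> F - sum_list \<gamma>) else 0)"
    by (simp add: lascoux_atom_def lookup_sum lookup_single when_def)
  also have "\<dots> = (\<Sum>F\<in>{F \<in> SetSkyFill \<gamma>. filling_expo \<gamma> F = m}.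
      monom 1 (num_entries \<gamma> F - sum_list \<gamma>))"
    using finite_SetSkyFill by (simp add: sum.inter_filter)
  also have "\<dots> = (\<Sum>F\<in>{F \<in> SetSkyFill \<gamma>. filling_expo \<gamma> F = m}.
      monom 1 ((\<Sum>x\<in>Poly_Mapping.keys m. Poly_Mapping.lookup m x) - sum_list \<gamma>))"
    by (intro sum.cong refl) (auto simp: num_entries_eq SetSkyFill_def)
  finally show ?thesis
    by (simp add: of_nat_poly smult_monom flip: monom_0) (simp add: smult_monom mult_monom)
qed

text \<open>All shapes that flatten to \<alpha> have the size of \<alpha>, so every contribution
  carries the same power of \<beta> and the counts add up.\<close>

lemma
  shows finite_fillings_of: "finite (fillings_of \<alpha> m)"
    and grothendieck_coeff: "grothendieck \<alpha> m = monom (of_nat (card (fillings_of \<alpha> m)))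
      ((\<Sum>x\<in>Poly_Mapping.keys m. Poly_Mapping.lookup m x) - sum_list \<alpha>)"
proof -
  let ?W = "{\<gamma> \<in> weak_compositions. flat \<gamma> = \<alpha>}"
  let ?t = "\<lambda>\<gamma>. {F \<in> SetSkyFill \<gamma>. filling_expo \<gamma> F = m}"
  let ?d = "(\<Sum>x\<in>Poly_Mapping.keys m. Poly_Mapping.lookup m x) - sum_list \<alpha>"
  let ?S = "{\<gamma> \<in> ?W. Poly_Mapping.lookup (lascoux_atom \<gamma>) m \<noteq> 0}"
  have fin: "finite (?t \<gamma>)" for \<gamma> using finite_SetSkyFill by simp
  \<comment> \<open>A positive count gives a nonzero coefficient, so these are exactly the shapes
    that admit a filling with exponent \<open>m\<close>. This turns summability into finiteness of
    \<open>fillings_of\<close>.\<close>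
  have S: "?S = {\<gamma> \<in> ?W. ?t \<gamma> \<noteq> {}}"
    using fin by (auto simp: lookup_lascoux_atom)
  have finS: "finite ?S"
    using grothendieck_has_coeff_sum[of \<alpha>] unfolding has_coeff_sum_def by blast
  have T: "fillings_of \<alpha> m = (SIGMA \<gamma>:?S. ?t \<gamma>)"
    unfolding S by (auto simp: fillings_of_def)
  show "finite (fillings_of \<alpha> m)"
    unfolding T using finS fin by (rule finite_SigmaI)
  have "grothendieck \<alpha> m = (\<Sum>\<gamma>\<in>?S. Poly_Mapping.lookup (lascoux_atom \<gamma>) m)"
    by (simp add: grothendieck_def coeff_sum_def)
  also have "\<dots> = (\<Sum>\<gamma>\<in>?S. monom (of_nat (card (?t \<gamma>))) ?d)"
    using sum_list_flat by (intro sum.cong) (auto simp: lookup_lascoux_atom)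
  also have "\<dots> = monom (of_nat (card (fillings_of \<alpha> m))) ?d"
    unfolding T using finS fin by (simp add: card_SigmaI monom_sum)
  finally show "grothendieck \<alpha> m = monom (of_nat (card (fillings_of \<alpha> m))) ?d" .
qed

section \<open>Relabelling\<close>

lemma Max_image_strict_mono_on:
  fixes \<phi> :: "'a::linorder \<Rightarrow> 'b::linorder"
  assumes "strict_mono_on S \<phi>" "A \<subseteq> S" "finite A" "A \<noteq> {}"
  shows "Max (\<phi> ` A) = \<phi> (Max A)"
proof (rule Max_eqI)
  fix y assume "y \<in> \<phi> ` A"
  then obtain x where x: "x \<in> A" "y = \<phi> x" by blast
  then have "x \<le> Max A" "x \<in> S" using assms by auto
  moreover have "Max A \<in> S" using Max_in[OF assms(3,4)] assms(2) by blast
  ultimately show "y \<le> \<phi> (Max A)"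
    using assms(1) x(2) by (cases "x = Max A") (auto simp: strict_mono_on_def intro!: less_imp_le)
qed (use assms Max_in[of A] in auto)

lemma sorted_list_of_set_image_strict_mono_on:
  fixes \<phi> :: "'a::linorder \<Rightarrow> 'b::linorder"
  assumes "strict_mono_on S \<phi>" "finite S"
  shows "sorted_list_of_set (\<phi> ` S) = map \<phi> (sorted_list_of_set S)"
proof (rule sorted_distinct_set_unique)
  have "sorted_wrt (<) (map \<phi> (sorted_list_of_set S))"
    unfolding sorted_wrt_map
    using strict_sorted_list_of_set[of S]
    by (rule sorted_wrt_mono_rel[rotated]) (use assms in \<open>simp add: strict_mono_on_def\<close>)
  then show "sorted (map \<phi> (sorted_list_of_set S))" "distinct (map \<phi> (sorted_list_of_set S))"
    by (auto simp: strict_sorted_iff)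
qed (use assms in auto)

text \<open>Only the row lengths as a function enter here, so moving rows affects
  \<open>flat\<close> just through the support of that function.\<close>

lemma flat_conv_nth_default:
  "flat \<gamma> = map (nth_default 0 \<gamma>) (sorted_list_of_set {i. nth_default 0 \<gamma> i \<noteq> 0})"
proof -
  have "flat \<gamma> = filter (\<lambda>a. a \<noteq> 0) (map snd (List.enumerate 0 \<gamma>))" by (simp add: flat_def)
  also have "\<dots> = map snd (filter (\<lambda>(_, x). x \<noteq> 0) (List.enumerate 0 \<gamma>))"
    by (simp only: filter_map comp_def case_prod_unfold)
  also have "\<dots> = map (nth_default 0 \<gamma> \<circ> fst) (filter (\<lambda>(_, x). x \<noteq> 0) (List.enumerate 0 \<gamma>))"
    by (rule map_cong) (auto, metis in_enumerate_iff_nth_default_eq less_irrefl)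
  finally show ?thesis by (simp only: sorted_list_of_set_nth_default map_map)
qed

text \<open>A nonempty row \<open>i\<close> contains \<open>i\<close> in its first box. So the rows
  in use are among the letters in use, and one map can act on both.\<close>

lemma box_row_in_keys:
  assumes F: "F \<in> SetSkyFill \<gamma>" and "(i, j) \<in> boxes \<gamma>"
  shows "i \<in> Poly_Mapping.keys (filling_expo \<gamma> F)"
  using SetSkyFill_expo[OF F, of i] assms(2) by (auto simp: boxes_def)

text \<open>By \<open>SetSkyFill_iff\<close>, semistandardness compares rows with rows, row lengths
  with row lengths and entries with entries, and the first column ties an entry to its row. Hence a
  single \<open>\<phi>\<close>, strictly increasing on a set \<open>S\<close> containing all
  letters, transports every condition.\<close>

lemma
  fixes \<phi> :: "nat \<Rightarrow> nat"
  assumes F: "F \<in> SetSkyFill \<gamma>"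
    and mono: "strict_mono_on S \<phi>"
    and keys: "Poly_Mapping.keys (filling_expo \<gamma> F) \<subseteq> S"
    and rows: "\<And>i. i \<in> S \<Longrightarrow> nth_default 0 \<gamma>' (\<phi> i) = nth_default 0 \<gamma> i"
    and rows0: "\<And>i. i \<notin> \<phi> ` S \<Longrightarrow> nth_default 0 \<gamma>' i = 0"
    and base: "\<And>i. F' i 0 = (if i < length \<gamma>' then {i} else {})"
    and img: "\<And>i j. i \<in> S \<Longrightarrow> 0 < j \<Longrightarrow> F' (\<phi> i) j = \<phi> ` F i j"
    and out: "\<And>i j. i \<notin> \<phi> ` S \<Longrightarrow> 0 < j \<Longrightarrow> F' i j = {}"
  shows SetSkyFill_relabel: "F' \<in> SetSkyFill \<gamma>'"
    and flat_relabel: "flat \<gamma>' = flat \<gamma>"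
    and lookup_relabel:
      "x \<in> S \<Longrightarrow> Poly_Mapping.lookup (filling_expo \<gamma>' F') (\<phi> x) = Poly_Mapping.lookup (filling_expo \<gamma> F) x"
    and lookup_relabel_0:
      "x \<notin> \<phi> ` S \<Longrightarrow> Poly_Mapping.lookup (filling_expo \<gamma>' F') x = 0"
proof -
  have V: "set_valued_filling \<gamma> F" using F by (simp add: SetSkyFill_def)
  have less: "\<phi> x < \<phi> y \<longleftrightarrow> x < y" if "x \<in> S" "y \<in> S" for x y
    using mono that by (metis strict_mono_on_def linorder_neqE_nat less_asym less_irrefl)
  have le: "\<phi> x \<le> \<phi> y \<longleftrightarrow> x \<le> y" if "x \<in> S" "y \<in> S" for x y
    using less[OF that(2,1)] by (simp flip: not_less)
  have inj: "inj_on \<phi> S" using mono by (rule strict_mono_on_imp_inj_on)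
  have entry: "F i j \<subseteq> S" if "(i, j) \<in> boxes \<gamma>" for i j
    using keys that by (auto simp: keys_filling_expo[OF V])
  have row: "i \<in> S" if "(i, j) \<in> boxes \<gamma>" for i j
    using box_row_in_keys[OF F that] keys by auto
  have box: "(\<phi> i, j) \<in> boxes \<gamma>' \<longleftrightarrow> (i, j) \<in> boxes \<gamma>" if "i \<in> S" for i j
    using rows[OF that] by (simp add: boxes_iff)
  \<comment> \<open>No box of \<open>\<gamma>'\<close> is new, since rows outside the image of
    \<open>S\<close> are empty. So every condition on \<open>F'\<close> can be pulled back to
    \<open>F\<close>.\<close>
  have box': "\<exists>i. i' = \<phi> i \<and> (i, j) \<in> boxes \<gamma> \<and> i \<in> S" if "(i', j) \<in> boxes \<gamma>'" for i' j
  proof (cases "i' \<in> \<phi> ` S")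
    case True
    then show ?thesis using box that by auto
  next
    case False
    then show ?thesis using rows0 that by (auto simp: boxes_iff)
  qed
  have F': "F' (\<phi> i) j = \<phi> ` F i j" if "(i, j) \<in> boxes \<gamma>" for i j
    using img row that by (auto simp: boxes_def)
  have fin: "finite (F i j) \<and> F i j \<noteq> {}" if "(i, j) \<in> boxes \<gamma>" for i j
    using V that by (auto simp: set_valued_filling_def)
  have anchor: "anchor F' (\<phi> i) j = \<phi> (anchor F i j)" if "(i, j) \<in> boxes \<gamma>" for i j
    unfolding anchor_def F'[OF that] using fin entry that
    by (intro Max_image_strict_mono_on[OF mono]) auto
  have anchor_S: "anchor F i j \<in> S" if "(i, j) \<in> boxes \<gamma>" for i j
    using fin entry Max_in that unfolding anchor_def by blast
  have nth: "\<gamma>' ! \<phi> i = \<gamma> ! i" if "(i, j) \<in> boxes \<gamma>" for i j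
    using rows[OF row[OF that]] that by (auto simp: nth_default_def boxes_def split: if_splits)
  have inv: "inversion_triple (\<phi> a) (\<phi> b) (\<phi> c) \<longleftrightarrow> inversion_triple a b c"
    if "a \<in> S" "b \<in> S" "c \<in> S" for a b c
    using that by (simp add: inversion_triple_def less le)
  have free: "can_be_free \<gamma>' F' (\<phi> x) (\<phi> i) j \<longleftrightarrow> can_be_free \<gamma> F x i j" if "x \<in> S" "i \<in> S" for x i j
    using that by (auto simp: can_be_free_def box anchor less le anchor_S)
  from SetSkyFill_iff[THEN iffD1, OF F] have
    C1: "\<forall>i. (i, 1) \<in> boxes \<gamma> \<longrightarrow> anchor F i 1 = i" and
    C2: "\<forall>i i' j. (i, j) \<in> boxes \<gamma> \<and> (i', j) \<in> boxes \<gamma> \<and> i \<noteq> i' \<longrightarrow> F i j \<inter> F i' j = {}" and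
    C3: "\<forall>i j. (i, j) \<in> boxes \<gamma> \<and> (i, Suc j) \<in> boxes \<gamma> \<longrightarrow> (\<forall>x\<in>F i j. \<forall>y\<in>F i (Suc j). y \<le> x)" and
    C4: "\<forall>i j k. i < j \<and> \<gamma> ! j \<le> \<gamma> ! i \<and> (i, k) \<in> boxes \<gamma> \<and> (i, Suc k) \<in> boxes \<gamma> \<and>
        (j, Suc k) \<in> boxes \<gamma> \<longrightarrow>
        inversion_triple (anchor F i (Suc k)) (anchor F j (Suc k)) (anchor F i k)" and
    C5: "\<forall>i j k. i < j \<and> \<gamma> ! i < \<gamma> ! j \<and> (i, k) \<in> boxes \<gamma> \<and> (j, k) \<in> boxes \<gamma> \<and>
        (j, Suc k) \<in> boxes \<gamma> \<longrightarrow>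
        inversion_triple (anchor F j (Suc k)) (anchor F i k) (anchor F j k)" and
    C6: "\<forall>i j x. (i, j) \<in> boxes \<gamma> \<and> x \<in> F i j \<and> x < anchor F i j \<longrightarrow>
        (\<forall>r<i. \<not> can_be_free \<gamma> F x r j)"
    by - (elim conjE, assumption)+
  have V': "set_valued_filling \<gamma>' F'"
    unfolding set_valued_filling_def
  proof (intro conjI)
    show "\<forall>(i, j)\<in>boxes \<gamma>'. finite (F' i j) \<and> F' i j \<noteq> {}"
    proof clarify
      fix i' j assume "(i', j) \<in> boxes \<gamma>'"
      then obtain i where i: "i' = \<phi> i" "(i, j) \<in> boxes \<gamma>" using box' by blast
      then show "finite (F' i' j) \<and> F' i' j \<noteq> {}" using F'[OF i(2)] fin[OF i(2)] by simp
    qed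
    show "\<forall>i<length \<gamma>'. F' i 0 = {i}" using base by simp
    show "\<forall>i j. (i, j) \<notin> boxes_basement \<gamma>' \<longrightarrow> F' i j = {}"
    proof (intro allI impI)
      fix i' j assume *: "(i', j) \<notin> boxes_basement \<gamma>'"
      show "F' i' j = {}"
      proof (cases "j = 0 \<or> i' \<notin> \<phi> ` S")
        case True
        then show ?thesis using * base out by (cases "j = 0") (auto simp: boxes_basement_def)
      next
        case False
        then obtain i where i: "i' = \<phi> i" "i \<in> S" by blast
        have "(i, j) \<notin> boxes \<gamma>"
          using * False box[OF i(2), of j] i by (auto simp: boxes_basement_def boxes_def)
        then have "(i, j) \<notin> boxes_basement \<gamma>" using False by (auto simp: boxes_basement_def boxes_def)
        then have "F i j = {}" using V by (auto simp: set_valued_filling_def)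
        then show ?thesis using img False i by auto
      qed
    qed
  qed
  show "F' \<in> SetSkyFill \<gamma>'"
    unfolding SetSkyFill_iff
  proof (intro conjI allI impI ballI V')
    fix i' assume "(i', 1) \<in> boxes \<gamma>'"
    then obtain i where i: "i' = \<phi> i" "(i, 1) \<in> boxes \<gamma>" using box' by blast
    then show "anchor F' i' 1 = i'" using C1 anchor by simp
  next
    fix i' l' j assume *: "(i', j) \<in> boxes \<gamma>' \<and> (l', j) \<in> boxes \<gamma>' \<and> i' \<noteq> l'"
    then obtain i where i: "i' = \<phi> i" "(i, j) \<in> boxes \<gamma>" using box' by blast
    obtain l where l: "l' = \<phi> l" "(l, j) \<in> boxes \<gamma>" using box' * by blast
    have "F i j \<inter> F l j = {}" using C2 i l * by blast
    then have "\<phi> ` F i j \<inter> \<phi> ` F l j = {}"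
      using inj_on_image_Int[OF inj entry[OF i(2)] entry[OF l(2)]] by simp
    then show "F' i' j \<inter> F' l' j = {}" using i l F' by simp
  next
    fix i' j x' y'
    assume *: "(i', j) \<in> boxes \<gamma>' \<and> (i', Suc j) \<in> boxes \<gamma>'" "x' \<in> F' i' j" "y' \<in> F' i' (Suc j)"
    then obtain i where i: "i' = \<phi> i" "(i, j) \<in> boxes \<gamma>" "i \<in> S" using box' by blast
    have s: "(i, Suc j) \<in> boxes \<gamma>" using * i box by blast
    obtain x y where "x \<in> F i j" "y \<in> F i (Suc j)" "x' = \<phi> x" "y' = \<phi> y"
      using * i s F' by blast
    then show "y' \<le> x'" using C3[rule_format, OF conjI[OF i(2) s]] entry[OF i(2)] entry[OF s] le by blast
  next
    fix i' j' k
    assume *: "i' < j' \<and> \<gamma>' ! j' \<le> \<gamma>' ! i' \<and> (i', k) \<in> boxes \<gamma>' \<and> (i', Suc k) \<in> boxes \<gamma>' \<and>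
        (j', Suc k) \<in> boxes \<gamma>'"
    then obtain i where i: "i' = \<phi> i" "(i, k) \<in> boxes \<gamma>" "i \<in> S" using box' by blast
    obtain j where j: "j' = \<phi> j" "(j, Suc k) \<in> boxes \<gamma>" "j \<in> S" using box' * by blast
    have s: "(i, Suc k) \<in> boxes \<gamma>" using * i box by blast
    have "inversion_triple (anchor F i (Suc k)) (anchor F j (Suc k)) (anchor F i k)"
      using * i j less nth[OF i(2)] nth[OF j(2)] by (intro C4[rule_format] conjI s) auto
    then show "inversion_triple (anchor F' i' (Suc k)) (anchor F' j' (Suc k)) (anchor F' i' k)"
      using i j s by (simp add: anchor inv anchor_S)
  next
    fix i' j' k
    assume *: "i' < j' \<and> \<gamma>' ! i' < \<gamma>' ! j' \<and> (i', k) \<in> boxes \<gamma>' \<and> (j', k) \<in> boxes \<gamma>' \<and>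
        (j', Suc k) \<in> boxes \<gamma>'"
    then obtain i where i: "i' = \<phi> i" "(i, k) \<in> boxes \<gamma>" "i \<in> S" using box' by blast
    obtain j where j: "j' = \<phi> j" "(j, k) \<in> boxes \<gamma>" "j \<in> S" using box' * by blast
    have s: "(j, Suc k) \<in> boxes \<gamma>" using * j box by blast
    have "inversion_triple (anchor F j (Suc k)) (anchor F i k) (anchor F j k)"
      using * i j less nth[OF i(2)] nth[OF j(2)] by (intro C5[rule_format] conjI s) auto
    then show "inversion_triple (anchor F' j' (Suc k)) (anchor F' i' k) (anchor F' j' k)"
      using i j s by (simp add: anchor inv anchor_S)
  next
    fix i' j x' r'
    assume *: "(i', j) \<in> boxes \<gamma>' \<and> x' \<in> F' i' j \<and> x' < anchor F' i' j" "r' < i'"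
    then obtain i where i: "i' = \<phi> i" "(i, j) \<in> boxes \<gamma>" "i \<in> S" using box' by blast
    obtain x where x: "x' = \<phi> x" "x \<in> F i j" "x \<in> S" using * i F' entry by blast
    show "\<not> can_be_free \<gamma>' F' x' r' j"
    proof
      \<comment> \<open>A competing row must own a box in column \<open>j\<close>, so it too is the
        image of a row in \<open>S\<close>; empty rows never compete.\<close>
      assume cf: "can_be_free \<gamma>' F' x' r' j"
      then obtain r where r: "r' = \<phi> r" "r \<in> S" using box' by (auto simp: can_be_free_def)
      have "can_be_free \<gamma> F x r j" using cf free x r by simp
      moreover have "x < anchor F i j" "r < i" using * i x r by (auto simp: anchor less anchor_S)
      ultimately show False using C6 i x by blast
    qed
  qed
  have supp: "{i. nth_default 0 \<gamma> i \<noteq> 0} \<subseteq> S"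
  proof
    fix i assume "i \<in> {i. nth_default 0 \<gamma> i \<noteq> 0}"
    then have "(i, 1) \<in> boxes \<gamma>" by (simp add: boxes_iff)
    then show "i \<in> S" by (rule row)
  qed
  have supp': "{i. nth_default 0 \<gamma>' i \<noteq> 0} = \<phi> ` {i. nth_default 0 \<gamma> i \<noteq> 0}"
  proof (rule set_eqI)
    fix i show "i \<in> {i. nth_default 0 \<gamma>' i \<noteq> 0} \<longleftrightarrow> i \<in> \<phi> ` {i. nth_default 0 \<gamma> i \<noteq> 0}"
      using rows rows0 supp by (cases "i \<in> \<phi> ` S") (auto simp: image_iff)
  qed
  \<comment> \<open>Flattening reads rows in increasing order, and \<open>\<phi>\<close> preserves
    that order on the support, so the nonzero parts appear in the same sequence.\<close>
  have "strict_mono_on {i. nth_default 0 \<gamma> i \<noteq> 0} \<phi>"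
    using mono supp by (auto simp: strict_mono_on_def)
  then have "flat \<gamma>' = map (nth_default 0 \<gamma>' \<circ> \<phi>) (sorted_list_of_set {i. nth_default 0 \<gamma> i \<noteq> 0})"
    unfolding flat_conv_nth_default[of \<gamma>'] supp'
    by (simp only: sorted_list_of_set_image_strict_mono_on finite_nth_default_neq_default map_map)
  also have "\<dots> = flat \<gamma>"
    unfolding flat_conv_nth_default[of \<gamma>]
  proof (intro map_cong refl)
    fix i assume "i \<in> set (sorted_list_of_set {i. nth_default 0 \<gamma> i \<noteq> 0})"
    then have "i \<in> S"
      using supp by (simp only: set_sorted_list_of_set finite_nth_default_neq_default) blast
    then show "(nth_default 0 \<gamma>' \<circ> \<phi>) i = nth_default 0 \<gamma> i" using rows by simp
  qed
  finally show "flat \<gamma>' = flat \<gamma>" .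
  show "Poly_Mapping.lookup (filling_expo \<gamma>' F') (\<phi> x) = Poly_Mapping.lookup (filling_expo \<gamma> F) x"
    if "x \<in> S"
  proof -
    \<comment> \<open>The exponent of a letter counts the boxes holding it; \<open>\<phi>\<close> on
      rows maps the boxes holding \<open>x\<close> bijectively onto those holding
      \<open>\<phi> x\<close>.\<close>
    let ?A = "{(i, j) \<in> boxes \<gamma>. x \<in> F i j}" and ?\<phi> = "\<lambda>(i, j :: nat). (\<phi> i, j)"
    have mem: "\<phi> x \<in> F' (\<phi> i) j \<longleftrightarrow> x \<in> F i j" if "(i, j) \<in> boxes \<gamma>" for i j
      unfolding F'[OF that] using inj_on_image_mem_iff[OF inj \<open>x \<in> S\<close> entry[OF that]] by simp
    have "{(i, j) \<in> boxes \<gamma>'. \<phi> x \<in> F' i j} = ?\<phi> ` ?A"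
    proof (intro equalityI subsetI)
      fix p assume "p \<in> {(i, j) \<in> boxes \<gamma>'. \<phi> x \<in> F' i j}"
      then obtain i' j where p: "p = (i', j)" "(i', j) \<in> boxes \<gamma>'" "\<phi> x \<in> F' i' j" by blast
      then obtain i where "i' = \<phi> i" "(i, j) \<in> boxes \<gamma>" using box' by blast
      then show "p \<in> ?\<phi> ` ?A" using p mem by (auto intro!: image_eqI[of _ _ "(i, j)"])
    next
      fix p assume "p \<in> ?\<phi> ` ?A"
      then show "p \<in> {(i, j) \<in> boxes \<gamma>'. \<phi> x \<in> F' i j}" using mem box row by auto
    qed
    moreover have "inj_on ?\<phi> ?A"
      by (rule inj_onI) (use inj row in \<open>auto dest: inj_onD\<close>)
    ultimately show ?thesis
      by (simp add: lookup_filling_expo V V' card_image)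
  qed
  show "Poly_Mapping.lookup (filling_expo \<gamma>' F') x = 0" if "x \<notin> \<phi> ` S"
  proof -
    have "x \<notin> F' i j" if "(i, j) \<in> boxes \<gamma>'" for i j
      using box'[OF that] F' entry \<open>x \<notin> \<phi> ` S\<close> by blast
    then have "{(i, j) \<in> boxes \<gamma>'. x \<in> F' i j} = {}" by auto
    then show ?thesis by (simp only: lookup_filling_expo[OF V'] card.empty)
  qed
qed

section \<open>Shapes as coefficient lists, and the relabelling injection\<close>

lemma weak_compositions_iff: "\<gamma> \<in> weak_compositions \<longleftrightarrow> no_trailing (HOL.eq 0) \<gamma>"
  by (auto simp: weak_compositions_def no_trailing_unfold)

lemma weak_compositions_eqI:
  assumes "\<gamma> \<in> weak_compositions" "\<gamma>' \<in> weak_compositions" "nth_default 0 \<gamma> = nth_default 0 \<gamma>'"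
  shows "\<gamma> = \<gamma>'"
  using assms by (metis weak_compositions_iff nth_default_eq_iff strip_while_idem)

text \<open>A coefficient list never ends in 0, so \<open>coeffs (Abs_poly g)\<close> serves as the
  weak composition with row lengths \<open>g\<close>.\<close>

lemma nth_default_coeffs_Abs_poly:
  fixes g :: "nat \<Rightarrow> nat"
  assumes "finite {i. g i \<noteq> 0}"
  shows "nth_default 0 (coeffs (Abs_poly g)) = g"
  using assms by (simp add: nth_default_coeffs_eq Abs_poly_inverse MOST_iff_cofinite)

text \<open>Relabelling along \<open>\<phi>\<close> is injective on fillings. An inequality
  suffices: relabelling in the other direction gives the opposite one.\<close>

lemma card_fillings_of_le:
  assumes mono: "strict_mono_on (Poly_Mapping.keys m) \<phi>"
    and keys: "Poly_Mapping.keys m' = \<phi> ` Poly_Mapping.keys m"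
    and lk: "\<And>x. x \<in> Poly_Mapping.keys m \<Longrightarrow> Poly_Mapping.lookup m' (\<phi> x) = Poly_Mapping.lookup m x"
  shows "card (fillings_of \<alpha> m) \<le> card (fillings_of \<alpha> m')"
proof -
  define S where "S = Poly_Mapping.keys m"
  define \<psi> where "\<psi> = inv_into S \<phi>"
  define rows where "rows \<gamma> i = (if i \<in> \<phi> ` S then nth_default 0 \<gamma> (\<psi> i) else 0)" for \<gamma> :: "nat list" and i
  define shape where "shape \<gamma> = coeffs (Abs_poly (rows \<gamma>))" for \<gamma>
  \<comment> \<open>The basement is set separately, since it lists all rows of the new shape,
    including empty rows outside the image of \<open>S\<close>.\<close>
  define fill where "fill \<gamma> F i j = (if j = 0 then if i < length (shape \<gamma>) then {i} else {}
      else if i \<in> \<phi> ` S then \<phi> ` F (\<psi> i) j else {})" for \<gamma> and F :: filling and i j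
  have inj: "inj_on \<phi> S" using mono unfolding S_def by (rule strict_mono_on_imp_inj_on)
  have \<psi>: "\<psi> (\<phi> i) = i" if "i \<in> S" for i using inj that by (simp add: \<psi>_def)
  have shape: "nth_default 0 (shape \<gamma>) = rows \<gamma>" for \<gamma>
    unfolding shape_def
  proof (rule nth_default_coeffs_Abs_poly, rule finite_subset)
    show "{i. rows \<gamma> i \<noteq> 0} \<subseteq> \<phi> ` S" by (auto simp: rows_def split: if_splits)
  qed (simp add: S_def)
  have weak: "shape \<gamma> \<in> weak_compositions" for \<gamma>
    by (simp add: shape_def weak_compositions_iff)
  have row: "(i, j) \<in> boxes \<gamma> \<Longrightarrow> i \<in> S" if "(\<gamma>, F) \<in> fillings_of \<alpha> m" for \<gamma> F i j
    using that box_row_in_keys[of F \<gamma>] by (auto simp: fillings_of_def S_def)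
  have supp: "nth_default 0 \<gamma> i = 0" if "(\<gamma>, F) \<in> fillings_of \<alpha> m" "i \<notin> S" for \<gamma> F i
    using row[OF that(1), of i 1] that(2) by (cases "nth_default 0 \<gamma> i") (auto simp: boxes_iff)
  let ?r = "\<lambda>(\<gamma>, F). (shape \<gamma>, fill \<gamma> F)"
  show ?thesis
  proof (rule card_inj_on_le[of ?r])
    show "inj_on ?r (fillings_of \<alpha> m)"
    proof (rule inj_onI, clarify)
      fix \<gamma> F \<gamma>' F'
      assume g: "(\<gamma>, F) \<in> fillings_of \<alpha> m" "(\<gamma>', F') \<in> fillings_of \<alpha> m"
        and eq: "shape \<gamma> = shape \<gamma>'" "fill \<gamma> F = fill \<gamma>' F'"
      have "nth_default 0 \<gamma> i = nth_default 0 \<gamma>' i" for i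
      proof (cases "i \<in> S")
        case True
        have "rows \<gamma> (\<phi> i) = rows \<gamma>' (\<phi> i)" using eq(1) shape by metis
        then show ?thesis using True \<psi> by (simp add: rows_def)
      qed (use supp g in auto)
      then have gg: "\<gamma> = \<gamma>'" using g by (auto simp: fillings_of_def intro!: weak_compositions_eqI)
      have "F i j = F' i j" for i j
      proof (cases "(i, j) \<in> boxes \<gamma>")
        case True
        then have i: "i \<in> S" "j \<noteq> 0" using row[OF g(1)] by (auto simp: boxes_def)
        have "fill \<gamma> F (\<phi> i) j = fill \<gamma>' F' (\<phi> i) j" using eq(2) by simp
        then have "\<phi> ` F i j = \<phi> ` F' i j" using i \<psi> by (simp add: fill_def)
        \<comment> \<open>Both fillings have exponent \<open>m\<close>, so their entries lie in
          \<open>S\<close>, where equal images under \<open>\<phi>\<close> mean equal sets.\<close>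
        moreover have "F i j \<subseteq> S" "F' i j \<subseteq> S"
          using g True gg keys_filling_expo[of \<gamma> F] keys_filling_expo[of \<gamma> F']
          by (auto simp: fillings_of_def SetSkyFill_def S_def)
        ultimately show ?thesis using inj by (simp add: inj_on_image_eq_iff)
      next
        case False
        then have "j = 0 \<and> i < length \<gamma> \<or> (i, j) \<notin> boxes_basement \<gamma>"
          by (auto simp: boxes_def boxes_basement_def)
        then show ?thesis
          using g gg by (auto simp: fillings_of_def SetSkyFill_def set_valued_filling_def)
      qed
      then show "\<gamma> = \<gamma>' \<and> F = F'" using gg by (simp add: fun_eq_iff)
    qed
    show "?r ` fillings_of \<alpha> m \<subseteq> fillings_of \<alpha> m'"
    proof clarify
      fix \<gamma> F assume g: "(\<gamma>, F) \<in> fillings_of \<alpha> m"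
      then have F: "F \<in> SetSkyFill \<gamma>" "filling_expo \<gamma> F = m" "flat \<gamma> = \<alpha>"
        by (auto simp: fillings_of_def)
      have rel: "strict_mono_on S \<phi>" "Poly_Mapping.keys (filling_expo \<gamma> F) \<subseteq> S"
        "\<And>i. i \<in> S \<Longrightarrow> nth_default 0 (shape \<gamma>) (\<phi> i) = nth_default 0 \<gamma> i"
        "\<And>i. i \<notin> \<phi> ` S \<Longrightarrow> nth_default 0 (shape \<gamma>) i = 0"
        "\<And>i. fill \<gamma> F i 0 = (if i < length (shape \<gamma>) then {i} else {})"
        "\<And>i j. i \<in> S \<Longrightarrow> 0 < j \<Longrightarrow> fill \<gamma> F (\<phi> i) j = \<phi> ` F i j"
        "\<And>i j. i \<notin> \<phi> ` S \<Longrightarrow> 0 < j \<Longrightarrow> fill \<gamma> F i j = {}"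
        using mono F(2) by (auto simp: S_def[symmetric] shape rows_def fill_def \<psi>)
      have "Poly_Mapping.lookup (filling_expo (shape \<gamma>) (fill \<gamma> F)) y = Poly_Mapping.lookup m' y" for y
      proof (cases "y \<in> \<phi> ` S")
        case True
        then obtain x where x: "y = \<phi> x" "x \<in> S" by blast
        then show ?thesis using lookup_relabel[OF F(1) rel] lk F(2) S_def by simp
      next
        case False
        then have "y \<notin> Poly_Mapping.keys m'" using keys S_def by simp
        then show ?thesis using lookup_relabel_0[OF F(1) rel False] by (simp add: in_keys_iff)
      qed
      then have "filling_expo (shape \<gamma>) (fill \<gamma> F) = m'" by (rule poly_mapping_eqI)
      then show "(shape \<gamma>, fill \<gamma> F) \<in> fillings_of \<alpha> m'"
        using weak flat_relabel[OF F(1) rel] SetSkyFill_relabel[OF F(1) rel] F(3)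
        by (simp add: fillings_of_def)
    qed
  qed (rule finite_fillings_of)
qed

section \<open>Exponents indexed by compositions\<close>

lemma lookup_expo_of_0: "length is = length \<alpha> \<Longrightarrow> x \<notin> set is \<Longrightarrow> Poly_Mapping.lookup (expo_of is \<alpha>) x = 0"
  by (force simp: expo_of_def lookup_sum lookup_single when_def in_set_conv_nth intro!: sum.neutral)

lemma lookup_expo_of:
  assumes "distinct is" "length is = length \<alpha>" "j < length \<alpha>"
  shows "Poly_Mapping.lookup (expo_of is \<alpha>) (is ! j) = \<alpha> ! j"
proof -
  have "Poly_Mapping.lookup (expo_of is \<alpha>) (is ! j) = (\<Sum>l<length \<alpha>. if l = j then \<alpha> ! l else 0)"
    unfolding expo_of_def lookup_sum lookup_single when_def
    by (intro sum.cong) (use assms in \<open>auto simp: nth_eq_iff_index_eq\<close>)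
  then show ?thesis using assms(3) by simp
qed

lemma keys_expo_of:
  assumes "\<alpha> \<in> compositions" "distinct is" "length is = length \<alpha>"
  shows "Poly_Mapping.keys (expo_of is \<alpha>) = set is"
proof (rule set_eqI)
  fix x show "x \<in> Poly_Mapping.keys (expo_of is \<alpha>) \<longleftrightarrow> x \<in> set is"
  proof (cases "x \<in> set is")
    case True
    then obtain j where "j < length \<alpha>" "x = is ! j" using assms(3) by (auto simp: in_set_conv_nth)
    then show ?thesis using lookup_expo_of[OF assms(2,3)] assms(1) True
      by (auto simp: in_keys_iff compositions_def)
  qed (simp add: in_keys_iff lookup_expo_of_0 assms)
qed

lemma sum_expo_of:
  fixes h :: "nat \<Rightarrow> nat"
  assumes "\<alpha> \<in> compositions" "distinct is" "length is = length \<alpha>"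
  shows "(\<Sum>x\<in>Poly_Mapping.keys (expo_of is \<alpha>). h x * Poly_Mapping.lookup (expo_of is \<alpha>) x) =
    (\<Sum>j<length \<alpha>. h (is ! j) * \<alpha> ! j)"
  unfolding keys_expo_of[OF assms]
  by (rule sum.reindex_bij_betw[OF bij_betw_nth[OF assms(2) refl refl], symmetric, THEN trans])
     (use assms in \<open>simp add: lookup_expo_of\<close>)

text \<open>The support in increasing order gives \<open>is\<close>, and the exponents along it give
  \<open>\<delta>\<close>. So a quasisymmetric series is determined by its coefficients at initial
  segments of the variables.\<close>

lemma expo_eq_expo_of:
  obtains "is" \<delta> where "\<delta> \<in> compositions" "length is = length \<delta>" "sorted_wrt (<) is" "m = expo_of is \<delta>"
proof
  let ?is = "sorted_list_of_set (Poly_Mapping.keys m)"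
  let ?\<delta> = "map (Poly_Mapping.lookup m) ?is"
  show "?\<delta> \<in> compositions" by (auto simp: compositions_def in_keys_iff)
  show "m = expo_of ?is ?\<delta>"
  proof (rule poly_mapping_eqI)
    fix x show "Poly_Mapping.lookup m x = Poly_Mapping.lookup (expo_of ?is ?\<delta>) x"
    proof (cases "x \<in> Poly_Mapping.keys m")
      case True
      then obtain j where "j < length ?is" "x = ?is ! j"
        by (metis finite_keys in_set_conv_nth set_sorted_list_of_set)
      then show ?thesis using lookup_expo_of[of ?is ?\<delta> j] by simp
    next
      case False
      then show ?thesis using lookup_expo_of_0[of ?is ?\<delta> x] by (simp add: in_keys_iff)
    qed
  qed
qed auto

lemma card_fillings_of_expo_of_le:
  assumes \<delta>: "\<delta> \<in> compositions"
    and is1: "length is = length \<delta>" "sorted_wrt (<) is"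
    and is2: "length is' = length \<delta>" "sorted_wrt (<) is'"
  shows "card (fillings_of \<alpha> (expo_of is \<delta>)) \<le> card (fillings_of \<alpha> (expo_of is' \<delta>))"
proof -
  have d: "distinct is" "distinct is'" using is1 is2 by (auto simp: strict_sorted_iff)
  \<comment> \<open>The j-th variable of \<open>is\<close> goes to the j-th variable of
    \<open>is'\<close>; as both lists increase, this map is strictly increasing on the
    support.\<close>
  define \<phi> where "\<phi> x = is' ! inv_into {..<length \<delta>} ((!) is) x" for x
  have \<phi>: "\<phi> (is ! j) = is' ! j" if "j < length \<delta>" for j
    using that d is1 by (simp add: \<phi>_def inv_into_f_f inj_on_nth)
  have set_is: "set is = (!) is ` {..<length \<delta>}" "set is' = (!) is' ` {..<length \<delta>}"
    using is1 is2 by (auto simp: set_conv_nth)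
  show ?thesis
  proof (rule card_fillings_of_le[of _ \<phi>])
    show "strict_mono_on (Poly_Mapping.keys (expo_of is \<delta>)) \<phi>"
      unfolding keys_expo_of[OF \<delta> d(1) is1(1)] set_is strict_mono_on_def
    proof (intro allI impI, elim conjE imageE)
      fix x y j l
      assume *: "x < y" "x = is ! j" "j \<in> {..<length \<delta>}" "y = is ! l" "l \<in> {..<length \<delta>}"
      have "j < l"
      proof (rule ccontr)
        assume "\<not> j < l"
        then have "is ! l \<le> is ! j"
          using is1 * sorted_nth_mono[of "is" l j] by (simp add: strict_sorted_iff)
        then show False using * by simp
      qed
      then show "\<phi> x < \<phi> y" using * \<phi> is2 by (simp add: sorted_wrt_nth_less)
    qed
    show "Poly_Mapping.keys (expo_of is' \<delta>) = \<phi> ` Poly_Mapping.keys (expo_of is \<delta>)"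
      unfolding keys_expo_of[OF \<delta> d(1) is1(1)] keys_expo_of[OF \<delta> d(2) is2(1)] set_is image_image
      using \<phi> by (intro image_cong) auto
    show "Poly_Mapping.lookup (expo_of is' \<delta>) (\<phi> x) = Poly_Mapping.lookup (expo_of is \<delta>) x"
      if "x \<in> Poly_Mapping.keys (expo_of is \<delta>)" for x
      using that unfolding keys_expo_of[OF \<delta> d(1) is1(1)] set_is
      using \<phi> lookup_expo_of d is1 is2 by auto
  qed
qed

section \<open>Quasisymmetry\<close>

lemma grothendieck_expo_of:
  assumes "\<delta> \<in> compositions" "length is = length \<delta>" "sorted_wrt (<) is"
  shows "grothendieck \<alpha> (expo_of is \<delta>) =
    monom (of_nat (card (fillings_of \<alpha> (expo_of is \<delta>)))) (sum_list \<delta> - sum_list \<alpha>)"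
  using sum_expo_of[of \<delta> "is" "\<lambda>_. 1"] assms
  by (simp add: grothendieck_coeff strict_sorted_iff sum_list_sum_nth atLeast0LessThan)

lemma grothendieck_in_QSym: "grothendieck \<alpha> \<in> QSym"
  unfolding QSym_def
proof (rule CollectI, intro ballI allI impI)
  fix \<delta> "is" :: "nat list" assume "\<delta> \<in> compositions" "length is = length \<delta> \<and> sorted_wrt (<) is"
  \<comment> \<open>Moving \<open>is\<close> to the initial segment and back bounds each count by
    the other; the power of \<beta> depends only on \<open>\<delta>\<close> and
    \<open>\<alpha>\<close>.\<close>
  then show "grothendieck \<alpha> (expo_of is \<delta>) = grothendieck \<alpha> (expo_of [0..<length \<delta>] \<delta>)"
    using card_fillings_of_expo_of_le[of \<delta> "is" "[0..<length \<delta>]" \<alpha>]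
      card_fillings_of_expo_of_le[of \<delta> "[0..<length \<delta>]" "is" \<alpha>]
    by (simp add: grothendieck_expo_of)
qed

lemma QSymD:
  assumes "f \<in> QSym" "\<delta> \<in> compositions" "length is = length \<delta>" "sorted_wrt (<) is"
  shows "f (expo_of is \<delta>) = f (expo_of [0..<length \<delta>] \<delta>)"
  using assms unfolding QSym_def by blast

lemma QSym_eqI:
  assumes "f \<in> QSym" "g \<in> QSym"
    and "\<And>\<delta>. \<delta> \<in> compositions \<Longrightarrow> f (expo_of [0..<length \<delta>] \<delta>) = g (expo_of [0..<length \<delta>] \<delta>)"
  shows "f = g"
proof
  fix m
  obtain "is" \<delta> where "\<delta> \<in> compositions" "length is = length \<delta>" "sorted_wrt (<) is" "m = expo_of is \<delta>"
    by (rule expo_eq_expo_of)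
  then show "f m = g m" using QSymD[OF assms(1)] QSymD[OF assms(2)] assms(3) by metis
qed

section \<open>Unitriangularity\<close>

lemma lookup_expo_of_upt:
  "Poly_Mapping.lookup (expo_of [0..<length \<delta>] \<delta>) x = nth_default 0 \<delta> x"
  using lookup_expo_of[of "[0..<length \<delta>]" \<delta> x] lookup_expo_of_0[of "[0..<length \<delta>]" \<delta> x]
  by (auto simp: nth_default_def)

lemma sum_boxes:
  fixes h :: "nat \<Rightarrow> nat"
  shows "(\<Sum>(i, j)\<in>boxes \<gamma>. h i) = (\<Sum>i<length \<gamma>. h i * \<gamma> ! i)"
proof -
  have "boxes \<gamma> = (SIGMA i:{..<length \<gamma>}. {1..\<gamma> ! i})" by (auto simp: boxes_def)
  then show ?thesis by (simp add: mult.commute flip: sum.Sigma)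
qed

text \<open>Every box holds at least one entry. For fixed \<delta> this leaves finitely many
  compositions \<alpha>, so infinite linear combinations are finite sums in each
  coefficient.\<close>

lemma fillings_of_sum_list_le:
  assumes \<delta>: "\<delta> \<in> compositions" and F: "(\<gamma>, F) \<in> fillings_of \<alpha> (expo_of [0..<length \<delta>] \<delta>)"
  shows "sum_list \<alpha> \<le> sum_list \<delta>"
proof -
  have V: "set_valued_filling \<gamma> F" using F by (simp add: fillings_of_def SetSkyFill_def)
  have "sum_list \<alpha> = sum_list \<gamma>" using F sum_list_flat[of \<gamma>] by (auto simp: fillings_of_def)
  also have "\<dots> = (\<Sum>(i, j)\<in>boxes \<gamma>. 1)"
    using sum_boxes[of "\<lambda>_. 1" \<gamma>] by (simp add: sum_list_sum_nth atLeast0LessThan)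
  also have "\<dots> \<le> num_entries \<gamma> F"
    unfolding num_entries_def
    by (intro sum_mono) (use V in \<open>auto simp: set_valued_filling_def Suc_le_eq card_gt_0_iff\<close>)
  also have "\<dots> = sum_list \<delta>"
    using sum_expo_of[of \<delta> "[0..<length \<delta>]" "\<lambda>_. 1"] \<delta> F num_entries_eq[OF V]
    by (simp add: fillings_of_def sum_list_sum_nth atLeast0LessThan)
  finally show ?thesis .
qed

text \<open>The last row of a nonempty weak composition is nonempty, so its index is a letter, hence
  below \<open>length \<delta>\<close>; flattening only shortens. If \<alpha> and \<delta> have
  equal length, both estimates are equalities and \<gamma> has no zero part.\<close>

lemma
  assumes \<delta>: "\<delta> \<in> compositions" and F: "(\<gamma>, F) \<in> fillings_of \<alpha> (expo_of [0..<length \<delta>] \<delta>)"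
  shows fillings_of_length_le: "length \<alpha> \<le> length \<delta>"
    and fillings_of_length_eq: "length \<alpha> = length \<delta> \<Longrightarrow> \<gamma> = \<alpha>"
proof -
  have \<gamma>: "\<gamma> \<in> weak_compositions" "flat \<gamma> = \<alpha>" and FS: "F \<in> SetSkyFill \<gamma>"
    and ex: "filling_expo \<gamma> F = expo_of [0..<length \<delta>] \<delta>"
    using F by (auto simp: fillings_of_def)
  have 1: "length \<gamma> \<le> length \<delta>"
  proof (cases "\<gamma> = []")
    case False
    then have "\<gamma> ! (length \<gamma> - 1) \<noteq> 0" using \<gamma>(1) by (simp add: weak_compositions_def last_conv_nth)
    then have "length \<gamma> - 1 \<in> Poly_Mapping.keys (expo_of [0..<length \<delta>] \<delta>)"
      using SetSkyFill_expo[OF FS] ex False by simp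
    then show ?thesis using keys_expo_of[OF \<delta>, of "[0..<length \<delta>]"] by simp
  qed simp
  have 2: "length \<alpha> \<le> length \<gamma>" using \<gamma>(2) by (auto simp: flat_def)
  show "length \<alpha> \<le> length \<delta>" using 1 2 by simp
  assume "length \<alpha> = length \<delta>"
  then have "length (filter (\<lambda>a. a \<noteq> 0) \<gamma>) = length \<gamma>" using 1 2 \<gamma>(2) by (simp add: flat_def)
  then have "\<forall>a\<in>set \<gamma>. a \<noteq> 0" using length_filter_less[of _ \<gamma> "\<lambda>a. a \<noteq> 0"] by fastforce
  then show "\<gamma> = \<alpha>" using \<gamma>(2) by (simp add: flat_def filter_id_conv)
qed

section \<open>The weight bound and the diagonal\<close>

lemma lookup_filling_expo_constant_rows:
  assumes "set_valued_filling \<gamma> F" "\<And>i j. (i, j) \<in> boxes \<gamma> \<Longrightarrow> F i j = {i}"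
  shows "Poly_Mapping.lookup (filling_expo \<gamma> F) x = nth_default 0 \<gamma> x"
proof -
  have "{(i, j) \<in> boxes \<gamma>. x \<in> F i j} = {x} \<times> {1..nth_default 0 \<gamma> x}"
    using assms(2) by (auto simp: boxes_iff)
  then show ?thesis by (simp add: lookup_filling_expo[OF assms(1)] card_cartesian_product)
qed

definition row_filling :: "nat list \<Rightarrow> filling" where
  "row_filling \<gamma> i j = (if (i, j) \<in> boxes_basement \<gamma> then {i} else {})"

text \<open>All anchors are row indices, so every triple is one of those in
  \<open>inversion_triple_basement\<close>, and singletons leave no free entries.\<close>

lemma row_filling_in_SetSkyFill: "row_filling \<gamma> \<in> SetSkyFill \<gamma>"
proof -
  have b: "row_filling \<gamma> i j = {i}" "anchor (row_filling \<gamma>) i j = i" if "(i, j) \<in> boxes \<gamma>" for i j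
    using that by (auto simp: row_filling_def anchor_def boxes_def boxes_basement_def)
  have "set_valued_filling \<gamma> (row_filling \<gamma>)"
    by (auto simp: set_valued_filling_def row_filling_def boxes_def boxes_basement_def)
  then show ?thesis
    unfolding SetSkyFill_iff by (auto simp: b inversion_triple_basement)
qed

text \<open>Entries of row \<open>i\<close> are at most \<open>i\<close>, so giving the entry \<open>i\<close> the weight \<open>k - i > 0\<close> makes the
  filling at least as heavy as the one in which row \<open>i\<close> consists of \<open>i\<close> alone.\<close>

definition weight :: "nat list \<Rightarrow> nat" where
  "weight \<alpha> = (\<Sum>i<length \<alpha>. (length \<alpha> - i) * \<alpha> ! i)"

lemma
  assumes \<delta>: "\<delta> \<in> compositions" and F: "(\<alpha>, F) \<in> fillings_of \<alpha>' (expo_of [0..<length \<delta>] \<delta>)"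
    and len: "length \<alpha> = length \<delta>"
  shows fillings_of_weight_le: "weight \<alpha> \<le> weight \<delta>"
    and fillings_of_weight_eq: "weight \<alpha> = weight \<delta> \<Longrightarrow> \<alpha> = \<delta> \<and> F = row_filling \<delta>"
proof -
  let ?k = "length \<delta>"
  have FS: "F \<in> SetSkyFill \<alpha>" and ex: "filling_expo \<alpha> F = expo_of [0..<?k] \<delta>"
    using F by (auto simp: fillings_of_def)
  then have V: "set_valued_filling \<alpha> F" by (simp add: SetSkyFill_def)
  have w\<delta>: "weight \<delta> = (\<Sum>(i, j)\<in>boxes \<alpha>. \<Sum>x\<in>F i j. ?k - x)"
    using sum_filling_expo[OF V, of "\<lambda>x. ?k - x"] sum_expo_of[OF \<delta>, of "[0..<?k]" "\<lambda>x. ?k - x"]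
    by (simp add: ex weight_def)
  have w\<alpha>: "weight \<alpha> = (\<Sum>(i, j)\<in>boxes \<alpha>. ?k - i)"
    by (simp add: sum_boxes weight_def len)
  have fin: "finite (F i j)" "F i j \<noteq> {}" "\<And>x. x \<in> F i j \<Longrightarrow> x \<le> i" "i < ?k"
    if "(i, j) \<in> boxes \<alpha>" for i j
    using V that SetSkyFill_entry_le[OF FS, of i j] len
    by (auto simp: set_valued_filling_def boxes_def)
  \<comment> \<open>A box of row \<open>i\<close> contains some \<open>x \<le> i\<close>, and this
    entry alone contributes at least \<open>?k - i\<close>.\<close>
  have le: "(case p of (i, j) \<Rightarrow> ?k - i) \<le> (case p of (i, j) \<Rightarrow> \<Sum>x\<in>F i j. ?k - x)"
    if pb: "p \<in> boxes \<alpha>" for p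
  proof -
    obtain i j where p: "p = (i, j)" by (cases p)
    obtain x where x: "x \<in> F i j" using fin(2)[of i j] pb p by blast
    have "?k - i \<le> ?k - x" using fin(3) pb p x by fastforce
    also have "\<dots> \<le> (\<Sum>x\<in>F i j. ?k - x)"
      using member_le_sum[OF x, of "\<lambda>x. ?k - x"] fin(1) pb p by simp
    finally show ?thesis by (simp add: p)
  qed
  show "weight \<alpha> \<le> weight \<delta>" unfolding w\<delta> w\<alpha> using le by (rule sum_mono)
  assume "weight \<alpha> = weight \<delta>"
  \<comment> \<open>A termwise inequality between finite sums with equal totals is an equality in
    each term.\<close>
  then have eq: "(case p of (i, j) \<Rightarrow> ?k - i) = (case p of (i, j) \<Rightarrow> \<Sum>x\<in>F i j. ?k - x)"
    if "p \<in> boxes \<alpha>" for p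
    unfolding w\<delta> w\<alpha> using le that finite_boxes by (rule sum_mono_inv)
  have F1: "F i j = {i}" if b: "(i, j) \<in> boxes \<alpha>" for i j
  proof -
    have "x = i" if x: "x \<in> F i j" for x
    proof -
      \<comment> \<open>Subtraction is truncated here; because \<open>i < ?k\<close>, the inequality
        does give \<open>i \<le> x\<close>.\<close>
      have "?k - x \<le> ?k - i"
        using member_le_sum[OF x, of "\<lambda>x. ?k - x"] fin(1)[OF b] eq[OF b] by simp
      then show ?thesis using fin(3)[OF b x] fin(4)[OF b] by simp
    qed
    then show ?thesis using fin(2)[OF b] by blast
  qed
  have "nth_default 0 \<alpha> x = nth_default 0 \<delta> x" for x
    using lookup_filling_expo_constant_rows[OF V F1, of x] by (simp add: ex lookup_expo_of_upt)
  then have "\<alpha> = \<delta>"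
    using len by (metis nth_default_nth nth_equalityI)
  moreover have "F i j = row_filling \<alpha> i j" for i j
    using F1 V by (cases j) (auto simp: row_filling_def set_valued_filling_def boxes_def boxes_basement_def)
  ultimately show "\<alpha> = \<delta> \<and> F = row_filling \<delta>" by (simp add: fun_eq_iff)
qed

text \<open>Length comes first because weights are compared only at equal length. Distinct
  compositions with equal length and weight are incomparable, and
  \<open>fillings_of_weight_eq\<close> shows that no filling relates them.\<close>

definition composition_order :: "(nat list \<times> nat list) set" where
  "composition_order = measures [length, weight]"

lemma fillings_of_nonempty:
  assumes \<delta>: "\<delta> \<in> compositions" and "fillings_of \<alpha> (expo_of [0..<length \<delta>] \<delta>) \<noteq> {}"
  shows "\<alpha> = \<delta> \<or> (\<alpha>, \<delta>) \<in> composition_order"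
proof (cases "length \<alpha> = length \<delta>")
  case True
  obtain \<gamma> F where F: "(\<gamma>, F) \<in> fillings_of \<alpha> (expo_of [0..<length \<delta>] \<delta>)"
    using assms(2) by auto
  then have F: "(\<alpha>, F) \<in> fillings_of \<alpha> (expo_of [0..<length \<delta>] \<delta>)"
    using fillings_of_length_eq[OF \<delta>] True by blast
  show ?thesis
    using fillings_of_weight_le[OF \<delta> F True] fillings_of_weight_eq[OF \<delta> F True] True
    by (auto simp: composition_order_def le_less)
next
  case False
  then show ?thesis
    using fillings_of_length_le[OF \<delta>] assms(2) by (fastforce simp: composition_order_def)
qed

text \<open>One filling, with no excess entries over the size of \<delta>, makes the diagonal
  coefficient exactly 1, with no power of \<beta>.\<close>

lemma fillings_of_diagonal:
  assumes \<delta>: "\<delta> \<in> compositions"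
  shows "fillings_of \<delta> (expo_of [0..<length \<delta>] \<delta>) = {(\<delta>, row_filling \<delta>)}"
proof (intro equalityI subsetI)
  fix p assume p: "p \<in> fillings_of \<delta> (expo_of [0..<length \<delta>] \<delta>)"
  obtain \<gamma> F where "p = (\<gamma>, F)" by (cases p)
  then show "p \<in> {(\<delta>, row_filling \<delta>)}"
    using fillings_of_length_eq[OF \<delta>] fillings_of_weight_eq[OF \<delta>] p by blast
next
  fix p assume p: "p \<in> {(\<delta>, row_filling \<delta>)}"
  have V: "set_valued_filling \<delta> (row_filling \<delta>)"
    using row_filling_in_SetSkyFill by (simp add: SetSkyFill_def)
  have "filling_expo \<delta> (row_filling \<delta>) = expo_of [0..<length \<delta>] \<delta>"
    using lookup_filling_expo_constant_rows[OF V]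
    by (intro poly_mapping_eqI)
      (auto simp: lookup_expo_of_upt row_filling_def boxes_def boxes_basement_def)
  moreover have "\<delta> \<in> weak_compositions" "flat \<delta> = \<delta>"
    using \<delta> by (auto simp: compositions_def weak_compositions_def flat_def filter_id_conv)
  ultimately show "p \<in> fillings_of \<delta> (expo_of [0..<length \<delta>] \<delta>)"
    using p row_filling_in_SetSkyFill by (simp add: fillings_of_def)
qed

lemma finite_compositions_sum_list_le: "finite {\<alpha> \<in> compositions. sum_list \<alpha> \<le> n}"
proof (rule finite_subset)
  show "{\<alpha> \<in> compositions. sum_list \<alpha> \<le> n} \<subseteq> {\<alpha>. length \<alpha> \<le> n \<and> set \<alpha> \<subseteq> {..n}}"
  proof clarify
    fix \<alpha> assume \<alpha>: "\<alpha> \<in> compositions" "sum_list \<alpha> \<le> n"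
    from \<alpha>(1) have "length \<alpha> \<le> sum_list \<alpha>"
      by (induction \<alpha>) (auto simp: compositions_def Suc_le_eq add_less_le_mono)
    then show "length \<alpha> \<le> n \<and> set \<alpha> \<subseteq> {..n}"
      using \<alpha>(2) member_le_sum_list by fastforce
  qed
qed (rule finite_bounded_lists)

section \<open>Linear systems that are unitriangular for a well-founded order\<close>

text \<open>Forward substitution: equation \<open>d\<close> determines \<open>c d\<close> from
  values at strictly smaller indices, without division because the diagonal is 1. Extensional
  functions fix the values outside \<open>A\<close>, so uniqueness concerns only those on
  \<open>A\<close>.\<close>

lemma unitriangular_unique_solution:
  fixes M :: "'a \<Rightarrow> 'a \<Rightarrow> 'b::comm_ring_1"
  assumes wf: "wf R"
    and fin: "\<And>d. d \<in> A \<Longrightarrow> finite {a \<in> A. M a d \<noteq> 0}"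
    and diag: "\<And>d. d \<in> A \<Longrightarrow> M d d = 1"
    and tri: "\<And>a d. a \<in> A \<Longrightarrow> d \<in> A \<Longrightarrow> M a d \<noteq> 0 \<Longrightarrow> a = d \<or> (a, d) \<in> R"
  shows "\<exists>!c. c \<in> A \<rightarrow>\<^sub>E UNIV \<and> (\<forall>d\<in>A. f d = (\<Sum>a\<in>{a \<in> A. M a d \<noteq> 0}. c a * M a d))"
proof -
  let ?L = "\<lambda>d. {a \<in> A. M a d \<noteq> 0} - {d}"
  have L: "(a, d) \<in> R" if "d \<in> A" "a \<in> ?L d" for a d using tri that by blast
  have split: "f d = (\<Sum>a\<in>{a \<in> A. M a d \<noteq> 0}. c a * M a d) \<longleftrightarrow> c d = f d - (\<Sum>a\<in>?L d. c a * M a d)"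
    if d: "d \<in> A" for c d
  proof -
    have "(\<Sum>a\<in>{a \<in> A. M a d \<noteq> 0}. c a * M a d) = c d + (\<Sum>a\<in>?L d. c a * M a d)"
      using sum.remove[OF fin[OF d], of d "\<lambda>a. c a * M a d"] d diag by simp
    then show ?thesis by (auto simp: algebra_simps)
  qed
  \<comment> \<open>Equation \<open>d\<close> solved for its diagonal unknown. That only values on
    \<open>?L d\<close> matter is what makes the recursion legitimate.\<close>
  define H where "H c d = f d - (\<Sum>a\<in>?L d. c a * M a d)" for c d
  have H_cong: "H c d = H c' d" if "\<And>a. a \<in> ?L d \<Longrightarrow> c a = c' a" for c c' d
    unfolding H_def using that by (intro arg_cong2[of _ _ _ _ "(-)"] sum.cong) auto
  define c where "c = restrict (wfrec R H) A"
  have c: "c d = H c d" if d: "d \<in> A" for d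
  proof -
    \<comment> \<open>\<open>cut\<close> changes values only off the predecessors of
      \<open>d\<close>, and by triangularity \<open>?L d\<close> consists of predecessors.\<close>
    have "c d = H (cut (wfrec R H) R d) d" using wfrec[OF wf, of H d] d by (simp add: c_def)
    also have "\<dots> = H c d"
      using L[OF d] by (intro H_cong) (simp add: cut_apply c_def)
    finally show ?thesis .
  qed
  show ?thesis
  proof (rule ex1I[of _ c])
    show "c \<in> A \<rightarrow>\<^sub>E UNIV \<and> (\<forall>d\<in>A. f d = (\<Sum>a\<in>{a \<in> A. M a d \<noteq> 0}. c a * M a d))"
      using split c by (auto simp: c_def H_def)
  next
    fix c' assume c': "c' \<in> A \<rightarrow>\<^sub>E UNIV \<and> (\<forall>d\<in>A. f d = (\<Sum>a\<in>{a \<in> A. M a d \<noteq> 0}. c' a * M a d))"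
    have "d \<in> A \<longrightarrow> c' d = c d" for d
      using wf
    proof (induction d rule: wf_induct_rule)
      case (less d)
      show ?case
      proof
        assume d: "d \<in> A"
        have "c' d = H c' d" unfolding H_def using split[OF d, of c'] c' d by simp
        also have "\<dots> = H c d"
          using L[OF d] less by (intro H_cong) auto
        finally show "c' d = c d" using c[OF d] by simp
      qed
    qed
    then show "c' = c" using c' by (intro extensionalityI[of _ A]) (auto simp: c_def PiE_iff)
  qed
qed

section \<open>Expansion of a quasisymmetric series as a unitriangular system\<close>

theorem theorem1p5:
  shows "(\<forall>\<alpha>\<in>compositions. grothendieck \<alpha> \<in> QSym) \<and>
    (\<forall>f\<in>QSym. \<exists>!c. c \<in> compositions \<rightarrow>\<^sub>E (UNIV :: int poly set) \<and>
       has_coeff_sum (\<lambda>\<alpha> m. c \<alpha> * grothendieck \<alpha> m) compositions f)"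
proof (intro conjI ballI grothendieck_in_QSym)
  fix f assume f: "f \<in> QSym"
  \<comment> \<open>The transition matrix: the coefficient of the monomial quasisymmetric function
    of \<open>\<delta>\<close> in \<open>grothendieck \<alpha>\<close>.\<close>
  let ?M = "\<lambda>\<alpha> \<delta>. grothendieck \<alpha> (expo_of [0..<length \<delta>] \<delta>)"
  have nonzero: "fillings_of \<alpha> (expo_of [0..<length \<delta>] \<delta>) \<noteq> {}"
    if "\<delta> \<in> compositions" "?M \<alpha> \<delta> \<noteq> 0" for \<alpha> \<delta>
    using that by (auto simp: grothendieck_expo_of)
  have fin: "finite {\<alpha> \<in> compositions. ?M \<alpha> \<delta> \<noteq> 0}" if "\<delta> \<in> compositions" for \<delta>
    by (rule finite_subset[OF _ finite_compositions_sum_list_le[of "sum_list \<delta>"]])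
      (use fillings_of_sum_list_le[OF that] nonzero[OF that] in fastforce)
  \<comment> \<open>Both sides of the expansion are quasisymmetric, so it amounts to one equation
    per composition \<open>\<delta>\<close>, summed over an index set independent of
    \<open>c\<close>.\<close>
  have sums: "has_coeff_sum (\<lambda>\<alpha> m. c \<alpha> * grothendieck \<alpha> m) compositions f \<longleftrightarrow>
      (\<forall>\<delta>\<in>compositions. f (expo_of [0..<length \<delta>] \<delta>) =
         (\<Sum>\<alpha>\<in>{\<alpha> \<in> compositions. ?M \<alpha> \<delta> \<noteq> 0}. c \<alpha> * ?M \<alpha> \<delta>))" for c
  proof -
    let ?g = "\<lambda>\<alpha> m. c \<alpha> * grothendieck \<alpha> m"
    have Q: "grothendieck \<alpha> (expo_of is \<delta>) = ?M \<alpha> \<delta>"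
      if "\<delta> \<in> compositions" "length is = length \<delta>" "sorted_wrt (<) is" for \<alpha> \<delta> "is"
      using grothendieck_in_QSym that by (rule QSymD)
    have g: "coeff_sum ?g compositions \<in> QSym"
      unfolding QSym_def coeff_sum_def
    proof (rule CollectI, intro ballI allI impI)
      fix \<delta> "is" :: "nat list"
      assume "\<delta> \<in> compositions" "length is = length \<delta> \<and> sorted_wrt (<) is"
      \<comment> \<open>Termwise equality also identifies the index sets of nonzero terms, which
        depend on the exponent.\<close>
      then have "grothendieck \<alpha> (expo_of is \<delta>) = ?M \<alpha> \<delta>" for \<alpha> by (intro Q) auto
      then show "(\<Sum>\<alpha>\<in>{\<alpha> \<in> compositions. ?g \<alpha> (expo_of is \<delta>) \<noteq> 0}. ?g \<alpha> (expo_of is \<delta>)) =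
          (\<Sum>\<alpha>\<in>{\<alpha> \<in> compositions. c \<alpha> * ?M \<alpha> \<delta> \<noteq> 0}. c \<alpha> * ?M \<alpha> \<delta>)"
        by simp
    qed
    have val: "coeff_sum ?g compositions (expo_of [0..<length \<delta>] \<delta>) =
        (\<Sum>\<alpha>\<in>{\<alpha> \<in> compositions. ?M \<alpha> \<delta> \<noteq> 0}. c \<alpha> * ?M \<alpha> \<delta>)" if "\<delta> \<in> compositions" for \<delta>
      unfolding coeff_sum_def by (intro sum.mono_neutral_left fin that) auto
    \<comment> \<open>Every exponent reduces to one on an initial segment of variables, where
      \<open>fin\<close> applies; so any choice of \<open>c\<close> is summable.\<close>
    have "finite {\<alpha> \<in> compositions. ?g \<alpha> m \<noteq> 0}" for m
    proof -
      obtain "is" \<delta> where *: "\<delta> \<in> compositions" "length is = length \<delta>" "sorted_wrt (<) is"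
        "m = expo_of is \<delta>" by (rule expo_eq_expo_of)
      show ?thesis
        unfolding *(4) Q[OF *(1-3)] by (rule finite_subset[OF _ fin[OF *(1)]]) auto
    qed
    then show ?thesis
      unfolding has_coeff_sum_def using val QSym_eqI[OF f g] by auto
  qed
  show "\<exists>!c. c \<in> compositions \<rightarrow>\<^sub>E (UNIV :: int poly set) \<and>
      has_coeff_sum (\<lambda>\<alpha> m. c \<alpha> * grothendieck \<alpha> m) compositions f"
    unfolding sums
  proof (rule unitriangular_unique_solution)
    show "wf composition_order" by (simp add: composition_order_def)
    show "?M \<delta> \<delta> = 1" if "\<delta> \<in> compositions" for \<delta>
      using that by (simp add: grothendieck_expo_of fillings_of_diagonal)
    show "\<alpha> = \<delta> \<or> (\<alpha>, \<delta>) \<in> composition_order" if "\<delta> \<in> compositions" "?M \<alpha> \<delta> \<noteq> 0" for \<alpha> \<delta>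
      using that nonzero fillings_of_nonempty by blast
  qed (rule fin)
qed

end
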